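(* Let $G$ be a CDF on $\mathbb{R}$ with finite second moment, mean $\mu_G$ and variance $\sigma_G^2>0$; let $\epsilon>0$, $\gamma>0$, and $g\in\mathcal{G}$. Assume that $\int_0^1(\tilde g_*'(t))^2dt<\infty$ and that, for every $\lambda\ge0$, $(h^\lambda_* )'(t)$ is not constant over $t\in(0,1)$. Then the quantile function of the worst-case distribution $F_{wo}$ (maximizer) for the problem $$\sup_{F\in\mathcal{M}^2(G;\epsilon)}\ \rho_g^F(X)+\gamma\,\mathbb{V}_F[X]$$ is $$F_{wo}^{-1}(t)=\mu_G+\frac{g(1)}{2(\gamma+\lambda^* )}+\frac{(h^{\lambda^*}_* )'(t)-h^{\lambda^*}(1)}{2\lambda^*},$$ where there exists an interval $[\eta,M]\subseteq(0,\infty)$ such that $$\lambda^*=\operatorname*{arg\,min}_{\lambda\in[\eta,M]}\ \frac{g(1)^2}{4(\gamma+\lambda)}+\frac{\Lambda(\lambda)^2}{4\lambda}-\lambda(\sigma_G^2-\epsilon).$$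
   Context: For a CDF $F$, $F^{-1}(t)=\inf\{x:F(x)\ge t\}$; $W_2(F,G)=\left(\int_0^1|F^{-1}(t)-G^{-1}(t)|^2dt\right)^{1/2}$; $\mathcal{M}^2(G;\epsilon)$ is the set of all CDFs $F$ on $\mathbb{R}$ with finite second moment and $W_2(F,G)\le\sqrt{\epsilon}$. $\mathbb{V}_F[X]$ is the variance of $X\sim F$. $\mathcal{G}$ is the set of functions $g:[0,1]\to\mathbb{R}$ that are continuous, of bounded variation, with $g(0)=0$ (not necessarily monotone, $g(1)$ arbitrary). The distortion riskmetric of $X\sim F$ is $$\rho_g^F(X)=\int_0^\infty g(1-F(z))\,dz+\int_{-\infty}^0\big(g(1-F(z))-g(1)\big)dz.$$ The dual distortion is $\tilde g(t)=g(1)-g(1-t)$. For $f\in\mathcal{G}$, the convex envelope is $f_*=\sup\{k\in\mathcal{G}:k\text{ convex on }[0,1],\ k\le f\}$ (pointwise supremum). For $\lambda\ge0$ define $$h^\lambda(t)=\tilde g(t)+2(\gamma+\lambda)\int_0^tG^{-1}(s)\,ds,\qquad \Lambda(\lambda)=\left(\int_0^1\big((h^\lambda_* )'(t)-h^\lambda(1)\big)^2dt\right)^{1/2}.$$ $\tilde g_*'$ and $(h^\lambda_* )'$ denote the left-hand derivatives of the convex envelopes $\tilde g_*$ and $h^\lambda_*$. *)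

theory Defs
  imports "HOL-Probability.Probability"
begin

section \<open>Distribution functions and quantiles\<close>

text \<open>The conditions are those under which \<^const>\<open>interval_measure\<close> yields a
  \<^locale>\<open>real_distribution\<close> whose \<^const>\<open>cdf\<close> is the given function.\<close>

definition is_cdf :: "(real \<Rightarrow> real) \<Rightarrow> bool" where
  "is_cdf F \<longleftrightarrow> mono F \<and> (\<forall>x. continuous (at_right x) F) \<and>
     (F \<longlongrightarrow> 0) at_bot \<and> (F \<longlongrightarrow> 1) at_top"

definition finite_second_moment :: "(real \<Rightarrow> real) \<Rightarrow> bool" where
  "finite_second_moment F \<longleftrightarrow> integrable (interval_measure F) (\<lambda>x. x\<^sup>2)"

definition cdf_mean :: "(real \<Rightarrow> real) \<Rightarrow> real" where
  "cdf_mean F = prob_space.expectation (interval_measure F) (\<lambda>x. x)"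

definition cdf_variance :: "(real \<Rightarrow> real) \<Rightarrow> real" where
  "cdf_variance F = prob_space.variance (interval_measure F) (\<lambda>x. x)"

text \<open>Meaningful for levels strictly between 0 and 1, where the set is nonempty and bounded
  below; only such levels are used.\<close>

definition quantile :: "(real \<Rightarrow> real) \<Rightarrow> real \<Rightarrow> real" where
  "quantile F t = Inf {x. F x \<ge> t}"

definition wasserstein2 :: "(real \<Rightarrow> real) \<Rightarrow> (real \<Rightarrow> real) \<Rightarrow> real" where
  "wasserstein2 F G = sqrt (LINT t:{0<..<1}|lborel. \<bar>quantile F t - quantile G t\<bar>\<^sup>2)"

definition ambiguity_set :: "(real \<Rightarrow> real) \<Rightarrow> real \<Rightarrow> (real \<Rightarrow> real) set" where
  "ambiguity_set G \<epsilon> =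
     {F. is_cdf F \<and> finite_second_moment F \<and> wasserstein2 F G \<le> sqrt \<epsilon>}"

section \<open>Distortion functions and riskmetrics\<close>

text \<open>A function on the unit interval is represented by a function on the reals, of which only
  the values on \<open>{0..1}\<close> matter.\<close>

definition bounded_variation_on :: "(real \<Rightarrow> real) \<Rightarrow> real set \<Rightarrow> bool" where
  "bounded_variation_on f S \<longleftrightarrow>
     (\<exists>B. \<forall>n (x :: nat \<Rightarrow> real). mono x \<and> (\<forall>i. x i \<in> S) \<longrightarrow>
        (\<Sum>i<n. \<bar>f (x (Suc i)) - f (x i)\<bar>) \<le> B)"

definition distortions :: "(real \<Rightarrow> real) set" where
  "distortions = {g. continuous_on {0..1} g \<and> bounded_variation_on g {0..1} \<and> g 0 = 0}"

definition dual_distortion :: "(real \<Rightarrow> real) \<Rightarrow> real \<Rightarrow> real" where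
  "dual_distortion g t = g 1 - g (1 - t)"

text \<open>For distributions with unbounded support the integrals in the riskmetric can be minus infinity, a case in which the
  Bochner integral would return 0. Hence the Lebesgue integral with values in
  \<^typ>\<open>ereal\<close>, as the difference of the integrals of the positive and the negative part. (The
  undefined form \<open>\<infinity> - \<infinity>\<close> evaluates to \<open>\<infinity>\<close>; it does not arise when the convex envelope of
  the dual distortion has a square-integrable derivative and \<open>F\<close> has a finite second moment.)\<close>

definition ext_integral :: "real set \<Rightarrow> (real \<Rightarrow> real) \<Rightarrow> ereal" where
  "ext_integral A f =
     enn2ereal (\<integral>\<^sup>+z\<in>A. ennreal (f z) \<partial>lborel) - enn2ereal (\<integral>\<^sup>+z\<in>A. ennreal (- f z) \<partial>lborel)"

definition riskmetric :: "(real \<Rightarrow> real) \<Rightarrow> (real \<Rightarrow> real) \<Rightarrow> ereal" where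
  "riskmetric g F =
     ext_integral {0..} (\<lambda>z. g (1 - F z)) + ext_integral {..0} (\<lambda>z. g (1 - F z) - g 1)"

section \<open>Convex envelopes\<close>

definition convex_env :: "(real \<Rightarrow> real) \<Rightarrow> real \<Rightarrow> real" where
  "convex_env f t =
     Sup {k t |k. k \<in> distortions \<and> convex_on {0..1} k \<and> (\<forall>s\<in>{0..1}. k s \<le> f s)}"

definition left_deriv :: "(real \<Rightarrow> real) \<Rightarrow> real \<Rightarrow> real" where
  "left_deriv f t = (THE D. (f has_real_derivative D) (at_left t))"

definition h_fun :: "(real \<Rightarrow> real) \<Rightarrow> (real \<Rightarrow> real) \<Rightarrow> real \<Rightarrow> real \<Rightarrow> real \<Rightarrow> real" where
  "h_fun g G \<gamma> l t =
     dual_distortion g t + 2 * (\<gamma> + l) * (LINT s:{0<..<t}|lborel. quantile G s)"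

definition Lam :: "(real \<Rightarrow> real) \<Rightarrow> (real \<Rightarrow> real) \<Rightarrow> real \<Rightarrow> real \<Rightarrow> real" where
  "Lam g G \<gamma> l =
     sqrt (LINT t:{0<..<1}|lborel. (left_deriv (convex_env (h_fun g G \<gamma> l)) t - h_fun g G \<gamma> l 1)\<^sup>2)"

end

theory Submission
  imports Defs
begin

text \<open>Write \<open>q\<close> and \<open>p\<close> for the quantile functions of \<open>F\<close> and \<open>G\<close>. A layer-cake formula turns the
  riskmetric plus \<open>2 (\<gamma> + l) \<integral> q p\<close> into an integral against \<open>h l\<close>, which is bounded by
  \<open>\<integral> q u\<close> with \<open>u\<close> the derivative of the convex envelope of \<open>h l\<close>; equality holds if \<open>q\<close> is an
  affine function of \<open>u\<close>, since \<open>u\<close> is locally constant off the contact set. Completing the square,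
  the Lagrangian with multiplier \<open>\<gamma> + l\<close> is at most \<open>dual l - l \<parallel>q - qopt l\<parallel>\<^sup>2\<close>, and \<open>dual\<close> is the
  objective of the theorem up to a constant. Hence the slack \<open>\<epsilon> - \<parallel>qopt l - p\<parallel>\<^sup>2\<close> is a subgradient of
  \<open>dual\<close>, the excess over the tangent controls \<open>\<parallel>qopt l' - qopt l\<parallel>\<^sup>2\<close>, and therefore the slack is
  continuous. As \<open>dual\<close> exceeds its value at 1 both near 0 and far out, the slack has a zero, where the
  constraint is tight and the duality gap closes. Equality in the bounds gives both uniqueness
  claims.\<close>

section \<open>Left derivatives of convex functions\<close>

text \<open>The variance is convex in the quantile function \<open>q\<close>, the wrong curvature
  for a maximization. The shift of the multiplier by \<open>\<gamma>\<close> repairs this: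
  \<open>\<gamma> * inn q q\<close> cancels in the Lagrangian and the strictly concave
  \<open>- l * inn q q - \<gamma> * (mean q)\<^sup>2\<close> remains, while the cross term of the
  squared distance turns the dual distortion into \<open>h l\<close>. The maximizer
  \<open>qopt l\<close> of the resulting quadratic functional is a nondecreasing affine function of
  \<open>u l\<close>, hence itself a quantile function. Two infinities shape the rest. The
  riskmetric may be minus infinity, even at \<open>G\<close>; such CDFs are split off by
  \<open>finite_risk\<close>, and the strictly feasible point is a truncation of \<open>G\<close>.
  And \<open>u l\<close> may be unbounded near 0 and 1, so its square integrability has to be
  derived from that of the derivative of \<open>convex_env (dual_distortion g)\<close>. The zero of
  the slack, found by the intermediate value theorem, takes the place of a minimax theorem: there
  the value of \<open>Fopt l\<close> equals the upper bound \<open>dual l\<close>.\<close>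

lemma has_left_deriv_unique:
  fixes f :: "real \<Rightarrow> real"
  assumes "(f has_real_derivative D) (at_left x)"
  shows "left_deriv f x = D"
  unfolding left_deriv_def
proof (rule the_equality)
  show "(f has_real_derivative D) (at_left x)" by fact
  fix E assume "(f has_real_derivative E) (at_left x)"
  with assms show "E = D"
    unfolding has_field_derivative_iff by (rule tendsto_unique[OF trivial_limit_at_left_real, rotated])
qed

lemma slope_swap: "(a - b) / (x - y) = (b - a) / (y - x)" for a b x y :: real
  by (metis minus_diff_eq minus_divide_divide)

lemma convex_slope_le_slope:
  fixes H :: "real \<Rightarrow> real"
  assumes "convex_on S H" "y \<in> S" "z \<in> S" "y < x" "x < z"
  shows "(H x - H y) / (x - y) \<le> (H z - H x) / (z - x)"
proof -
  have "(H y - H x) / (y - x) \<le> (H x - H z) / (x - z)"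
    using convex_on_slope_le[OF assms] by linarith
  then show ?thesis
    unfolding slope_swap[of "H y"] slope_swap[of "H x" "H z"] .
qed

lemma convex_slope_mono_left:
  fixes H :: "real \<Rightarrow> real"
  assumes "convex_on S H" "y \<in> S" "x \<in> S" "y \<le> y'" "y' < x"
  shows "(H x - H y) / (x - y) \<le> (H x - H y') / (x - y')"
proof (cases "y = y'")
  case False
  have "(H y - H x) / (y - x) \<le> (H y' - H x) / (y' - x)"
    using convex_on_slope_le(2)[OF assms(1,2,3), of y'] False assms by simp
  then show ?thesis
    unfolding slope_swap[of _ "H x"] .
qed simp

text \<open>Backward slopes increase as their base point approaches \<open>x\<close> and are bounded
  by every forward slope, so their supremum is the left derivative.\<close>

lemma
  fixes H :: "real \<Rightarrow> real"
  assumes conv: "convex_on {a..b} H" and x: "a < x" "x < b"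
  shows convex_has_left_deriv: "(H has_real_derivative left_deriv H x) (at_left x)"
    and convex_slope_le_left_deriv: "\<And>y. a \<le> y \<Longrightarrow> y < x \<Longrightarrow> (H x - H y) / (x - y) \<le> left_deriv H x"
    and convex_left_deriv_le_slope: "\<And>z. x < z \<Longrightarrow> z \<le> b \<Longrightarrow> left_deriv H x \<le> (H z - H x) / (z - x)"
proof -
  let ?s = "\<lambda>y. (H x - H y) / (x - y)"
  let ?S = "SUP y\<in>{a..<x}. ?s y"
  have up: "?s y \<le> (H z - H x) / (z - x)" if "y \<in> {a..<x}" "x < z" "z \<le> b" for y z
    using convex_slope_le_slope[OF conv] that x by auto
  then have bdd: "bdd_above (?s ` {a..<x})"
    using x by (intro bdd_aboveI[of _ "(H b - H x) / (b - x)"]) auto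
  have "((\<lambda>y. (H y - H x) / (y - x)) \<longlongrightarrow> ?S) (at_left x)"
  proof (rule order_tendstoI)
    fix l assume "l < ?S"
    then obtain y0 where y0: "y0 \<in> {a..<x}" "l < ?s y0"
      using less_cSUP_iff[OF _ bdd, of l] x by auto
    show "\<forall>\<^sub>F y in at_left x. l < (H y - H x) / (y - x)"
      unfolding eventually_at_left_field
    proof (intro exI[of _ y0] conjI allI impI)
      fix y assume "y0 < y" "y < x"
      then have "?s y0 \<le> ?s y"
        using convex_slope_mono_left[OF conv, of y0 x y] y0 x by auto
      then show "l < (H y - H x) / (y - x)"
        using y0 unfolding slope_swap[of "H y"] by linarith
    qed (use y0 in auto)
  next
    fix u assume "?S < u"
    show "\<forall>\<^sub>F y in at_left x. (H y - H x) / (y - x) < u"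
      unfolding eventually_at_left_field
    proof (intro exI[of _ a] conjI allI impI)
      fix y assume "a < y" "y < x"
      then have "?s y \<le> ?S"
        by (intro cSUP_upper bdd) auto
      then show "(H y - H x) / (y - x) < u"
        using \<open>?S < u\<close> unfolding slope_swap[of "H y"] by linarith
    qed (use x in auto)
  qed
  then have D: "(H has_real_derivative ?S) (at_left x)"
    by (simp add: has_field_derivative_iff)
  note eq = has_left_deriv_unique[OF D]
  show "(H has_real_derivative left_deriv H x) (at_left x)"
    using D eq by simp
  show "?s y \<le> left_deriv H x" if "a \<le> y" "y < x" for y
    unfolding eq using that by (intro cSUP_upper bdd) auto
  show "left_deriv H x \<le> (H z - H x) / (z - x)" if "x < z" "z \<le> b" for z
    unfolding eq using that x by (intro cSUP_least up) auto
qed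

lemma convex_left_deriv_increment:
  fixes H :: "real \<Rightarrow> real"
  assumes "convex_on {a..b} H" "a < x" "x \<le> y" "y < b"
  shows "left_deriv H x * (y - x) \<le> H y - H x" "H y - H x \<le> left_deriv H y * (y - x)"
proof -
  show "left_deriv H x * (y - x) \<le> H y - H x"
    using convex_left_deriv_le_slope[OF assms(1), of x y] assms
    by (cases "x = y") (auto simp: field_simps)
  show "H y - H x \<le> left_deriv H y * (y - x)"
    using convex_slope_le_left_deriv[OF assms(1), of y x] assms
    by (cases "x = y") (auto simp: field_simps)
qed

lemma convex_left_deriv_mono:
  fixes H :: "real \<Rightarrow> real"
  assumes "convex_on {a..b} H"
  shows "mono_on {a<..<b} (left_deriv H)"
proof (rule mono_onI)
  fix x y assume xy: "x \<in> {a<..<b}" "y \<in> {a<..<b}" "x \<le> y"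
  show "left_deriv H x \<le> left_deriv H y"
  proof (cases "x = y")
    case False
    then have "left_deriv H x \<le> (H y - H x) / (y - x)" "(H y - H x) / (y - x) \<le> left_deriv H y"
      using convex_left_deriv_le_slope[OF assms, of x y] convex_slope_le_left_deriv[OF assms, of y x] xy
      by auto
    then show ?thesis by simp
  qed simp
qed

lemma convex_on_continuous_interior:
  fixes H :: "real \<Rightarrow> real"
  assumes "convex_on {a..b} H"
  shows "continuous_on {a<..<b} H"
  using assms by (intro convex_on_continuous convex_on_subset[OF assms]) auto

text \<open>The upper estimate is monotonicity. For the lower one, the slope from a fixed
  \<open>y < x\<close> to \<open>z\<close> is continuous in \<open>z\<close> and bounds
  \<open>left_deriv H z\<close> from below. Left continuity is what later makes a nondecreasing
  affine function of \<open>left_deriv H\<close> a quantile function.\<close>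

lemma convex_left_deriv_left_cont:
  fixes H :: "real \<Rightarrow> real"
  assumes conv: "convex_on {a..b} H" and x: "a < x" "x < b"
  shows "(left_deriv H \<longlongrightarrow> left_deriv H x) (at_left x)"
proof (rule order_tendstoI)
  fix u assume u: "left_deriv H x < u"
  show "\<forall>\<^sub>F y in at_left x. left_deriv H y < u"
    unfolding eventually_at_left_field
  proof (intro exI[of _ a] conjI allI impI)
    fix y assume "a < y" "y < x"
    then show "left_deriv H y < u"
      using mono_onD[OF convex_left_deriv_mono[OF conv], of y x] x u by auto
  qed (use x in auto)
next
  fix l assume l: "l < left_deriv H x"
  have "((\<lambda>y. (H y - H x) / (y - x)) \<longlongrightarrow> left_deriv H x) (at_left x)"
    using convex_has_left_deriv[OF assms] by (simp add: has_field_derivative_iff)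
  then have "\<forall>\<^sub>F y in at_left x. l < (H y - H x) / (y - x)"
    using l by (rule order_tendstoD)
  then obtain w where w: "w < x" "\<And>y. w < y \<Longrightarrow> y < x \<Longrightarrow> l < (H y - H x) / (y - x)"
    unfolding eventually_at_left_field by auto
  define y where "y = (max w a + x) / 2"
  have y: "a < y" "y < x" "w < y"
    using w x by (auto simp: y_def)
  have "isCont H x"
    using convex_on_continuous_interior[OF conv] x by (simp add: continuous_on_eq_continuous_at)
  then have "((\<lambda>z. (H y - H z) / (y - z)) \<longlongrightarrow> (H y - H x) / (y - x)) (at_left x)"
    using y by (intro tendsto_intros) (auto simp: isCont_def intro: tendsto_within_subset)
  then have "\<forall>\<^sub>F z in at_left x. l < (H y - H z) / (y - z)"
    using w(2)[OF y(3,2)] by (rule order_tendstoD)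
  moreover have "\<forall>\<^sub>F z in at_left x. y < z" "\<forall>\<^sub>F z in at_left x. z < x"
    using y by (auto simp: eventually_at_left_field)
  ultimately show "\<forall>\<^sub>F z in at_left x. l < left_deriv H z"
  proof eventually_elim
    case (elim z)
    then have "(H z - H y) / (z - y) \<le> left_deriv H z"
      using convex_slope_le_left_deriv[OF conv, of z y] y x by auto
    then show ?case
      using elim(1) unfolding slope_swap[of "H y"] by linarith
  qed
qed

text \<open>Over \<open>n + 1\<close> equal steps the increments of \<open>d\<close> telescope, so
  the total change of \<open>\<Phi>\<close> is at most a constant divided by \<open>n + 1\<close>.
  This compares antiderivatives of a monotone function without differentiating them, which could
  fail at its jumps.\<close>

lemma eq_of_increment_le:
  fixes \<Phi> d :: "real \<Rightarrow> real"
  assumes xy: "x \<le> y"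
    and le: "\<And>u v. x \<le> u \<Longrightarrow> u \<le> v \<Longrightarrow> v \<le> y \<Longrightarrow> \<bar>\<Phi> v - \<Phi> u\<bar> \<le> (d v - d u) * (v - u)"
  shows "\<Phi> x = \<Phi> y"
proof -
  have "\<bar>\<Phi> y - \<Phi> x\<bar> \<le> (d y - d x) * (y - x) / real (Suc n)" for n
  proof -
    define p where "p i = x + real i * ((y - x) / real (Suc n))" for i
    have "x + N * ((y - x) / N) = y" if "N \<noteq> 0" for N :: real
      using that by simp
    from this[OF of_nat_neq_0] have pn: "p (Suc n) = y"
      unfolding p_def .
    have p0: "p 0 = x"
      by (simp add: p_def)
    have "x + real (Suc i) * \<delta> - (x + real i * \<delta>) = \<delta>" for i \<delta>
      by (simp add: algebra_simps)
    then have step: "p (Suc i) - p i = (y - x) / real (Suc n)" for i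
      unfolding p_def by blast
    have pmono: "p i \<le> p j" if "i \<le> j" for i j
      unfolding p_def using that xy by (intro add_left_mono mult_right_mono divide_nonneg_nonneg) auto
    have "\<bar>\<Phi> y - \<Phi> x\<bar> = \<bar>\<Sum>i<Suc n. \<Phi> (p (Suc i)) - \<Phi> (p i)\<bar>"
      unfolding sum_lessThan_telescope[of "\<lambda>i. \<Phi> (p i)"] p0 pn ..
    also have "\<dots> \<le> (\<Sum>i<Suc n. \<bar>\<Phi> (p (Suc i)) - \<Phi> (p i)\<bar>)"
      by (rule sum_abs)
    also have "\<dots> \<le> (\<Sum>i<Suc n. (d (p (Suc i)) - d (p i)) * ((y - x) / real (Suc n)))"
    proof (rule sum_mono)
      fix i assume "i \<in> {..<Suc n}"
      then have "x \<le> p i" "p i \<le> p (Suc i)" "p (Suc i) \<le> y"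
        using pmono[of 0 i] pmono[of i "Suc i"] pmono[of "Suc i" "Suc n"] p0 pn by auto
      from le[OF this] show "\<bar>\<Phi> (p (Suc i)) - \<Phi> (p i)\<bar> \<le> (d (p (Suc i)) - d (p i)) * ((y - x) / real (Suc n))"
        unfolding step .
    qed
    also have "\<dots> = (d y - d x) * ((y - x) / real (Suc n))"
      unfolding sum_distrib_right[symmetric] sum_lessThan_telescope[of "\<lambda>i. d (p i)"] p0 pn ..
    finally show ?thesis by simp
  qed
  moreover have "(\<lambda>n. (d y - d x) * (y - x) / real (Suc n)) \<longlonglongrightarrow> 0"
    by (rule LIMSEQ_Suc[OF lim_const_over_n])
  ultimately have "\<bar>\<Phi> y - \<Phi> x\<bar> \<le> 0"
    by (intro LIMSEQ_le_const) auto
  then show ?thesis by simp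
qed

section \<open>Integrals of the left derivative of a convex function\<close>

lemma set_integrable_mono_on_Icc:
  fixes f :: "real \<Rightarrow> real"
  assumes "mono_on {x..y} f"
  shows "set_integrable lborel {x..y} f"
proof -
  have bd: "\<bar>f t\<bar> \<le> \<bar>f x\<bar> + \<bar>f y\<bar>" if "t \<in> {x..y}" for t
    using mono_onD[OF assms, of x t] mono_onD[OF assms, of t y] that by auto
  have "f \<in> borel_measurable (restrict_space borel {x..y})"
    using assms by (rule borel_measurable_mono_on_fnc)
  then have "(\<lambda>t. indicator {x..y} t *\<^sub>R f t) \<in> borel_measurable lborel"
    by (subst (asm) borel_measurable_restrict_space_iff) auto
  moreover have "set_integrable lborel {x..y} (\<lambda>_. \<bar>f x\<bar> + \<bar>f y\<bar>)"
    by (intro borel_integrable_atLeastAtMost') auto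
  ultimately show ?thesis
    unfolding set_integrable_def
  proof (elim Bochner_Integration.integrable_bound[rotated], intro AE_I2)
    show "norm (indicat_real {x..y} t *\<^sub>R f t) \<le> norm (indicat_real {x..y} t *\<^sub>R (\<bar>f x\<bar> + \<bar>f y\<bar>))" for t
      using bd[of t] by (auto simp: indicator_def)
  qed
qed

text \<open>Both \<open>H\<close> and the integral of its left derivative have increments between
  \<open>left_deriv H u * (v - u)\<close> and \<open>left_deriv H v * (v - u)\<close>, so
  \<open>eq_of_increment_le\<close> applies to their difference.\<close>

lemma convex_left_deriv_FTC:
  fixes H :: "real \<Rightarrow> real"
  assumes conv: "convex_on {a..b} H" and xy: "a < x" "x \<le> y" "y < b"
  shows "set_integrable lborel {x..y} (left_deriv H)"
    and "(LINT t:{x..y}|lborel. left_deriv H t) = H y - H x"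
proof -
  let ?d = "left_deriv H"
  have mono: "mono_on {u..v} ?d" if "x \<le> u" "v \<le> y" for u v
    using convex_left_deriv_mono[OF conv] by (rule mono_on_subset) (use xy that in auto)
  have int: "?d integrable_on {u..v}" if "x \<le> u" "v \<le> y" for u v
    using mono[OF that] by (rule integrable_on_mono_on)
  define \<Phi> where "\<Phi> s = integral {x..s} ?d - H s" for s
  have "\<Phi> x = \<Phi> y"
  proof (rule eq_of_increment_le[OF xy(2)])
    fix u v assume uv: "x \<le> u" "u \<le> v" "v \<le> y"
    have 1: "integral {x..v} ?d = integral {x..u} ?d + integral {u..v} ?d"
      using Henstock_Kurzweil_Integration.integral_combine[OF uv(1,2) int] uv by simp
    have "integral {u..v} (\<lambda>_. ?d u) \<le> integral {u..v} ?d" "integral {u..v} ?d \<le> integral {u..v} (\<lambda>_. ?d v)"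
      using mono_onD[OF mono[OF uv(1,3)]] uv by (intro integral_le int integrable_const_ivl; auto)+
    then have 2: "?d u * (v - u) \<le> integral {u..v} ?d" "integral {u..v} ?d \<le> ?d v * (v - u)"
      using uv by (auto simp: mult.commute)
    have 3: "?d u * (v - u) \<le> H v - H u" "H v - H u \<le> ?d v * (v - u)"
      using convex_left_deriv_increment[OF conv, of u v] uv xy by auto
    show "\<bar>\<Phi> v - \<Phi> u\<bar> \<le> (?d v - ?d u) * (v - u)"
      using 1 2 3 unfolding \<Phi>_def by (auto simp: abs_le_iff algebra_simps)
  qed
  then have I: "integral {x..y} ?d = H y - H x"
    by (simp add: \<Phi>_def)
  show S: "set_integrable lborel {x..y} ?d"
    by (intro set_integrable_mono_on_Icc mono) auto
  show "(LINT t:{x..y}|lborel. ?d t) = H y - H x"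
    using set_borel_integral_eq_integral(2)[OF S] I by simp
qed

text \<open>Meant for \<open>f\<close> unbounded near the ends of the interval: along an exhaustion
  by compact intervals the integrals converge because \<open>\<Phi>\<close> is continuous up to
  \<open>a\<close> and \<open>b\<close>.\<close>

lemma set_integrable_nonneg_antideriv:
  fixes f \<Phi> :: "real \<Rightarrow> real"
  assumes ab: "a < b" and cont: "continuous_on {a..b} \<Phi>"
    and nonneg: "\<And>t. a < t \<Longrightarrow> t < b \<Longrightarrow> 0 \<le> f t"
    and meas: "set_borel_measurable lborel {a<..<b} f"
    and int: "\<And>x y. a < x \<Longrightarrow> x < y \<Longrightarrow> y < b \<Longrightarrow> set_integrable lborel {x..y} f"
    and eq: "\<And>x y. a < x \<Longrightarrow> x < y \<Longrightarrow> y < b \<Longrightarrow> (LINT t:{x..y}|lborel. f t) = \<Phi> y - \<Phi> x"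
  shows "set_integrable lborel {a<..<b} f"
proof -
  have "ereal a < ereal b" using ab by simp
  then obtain u l :: "nat \<Rightarrow> real" where ul:
    "einterval a b = (\<Union>i. {l i .. u i})" "incseq u" "decseq l" "\<And>i. l i < u i"
    "\<And>i. ereal a < l i" "\<And>i. u i < ereal b" "(\<lambda>i. ereal (l i)) \<longlonglongrightarrow> a" "(\<lambda>i. ereal (u i)) \<longlonglongrightarrow> b"
    by (rule einterval_Icc_approximation) (rule that)
  then have lim: "l \<longlonglongrightarrow> a" "u \<longlonglongrightarrow> b" and bd: "\<And>i. a < l i" "\<And>i. u i < b"
    by auto
  have bd': "a < u i" "l i < b" for i
    using ul(4)[of i] bd[of i] by auto
  have "(\<lambda>i. \<Phi> (u i) - \<Phi> (l i)) \<longlonglongrightarrow> \<Phi> b - \<Phi> a"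
    using ab bd bd' lim less_imp_le[OF bd(1)] less_imp_le[OF bd(2)] less_imp_le[OF bd'(1)] less_imp_le[OF bd'(2)]
    by (intro tendsto_diff continuous_on_tendsto_compose[OF cont]) simp_all
  moreover have "(LBINT x=l i..u i. f x) = \<Phi> (u i) - \<Phi> (l i)" for i
    using ul(4)[of i] bd eq by (subst interval_integral_Icc) auto
  ultimately have "(\<lambda>i. LBINT x=l i..u i. f x) \<longlonglongrightarrow> \<Phi> b - \<Phi> a"
    by simp
  from interval_integral_Icc_approx_nonneg(1)[OF _ ul _ _ _ this]
  have "set_integrable lborel (einterval a b) f"
    using ab bd ul(4) int meas nonneg by (auto simp: einterval_eq)
  then show ?thesis by (simp add: einterval_eq)
qed

lemma set_borel_measurable_mono_on:
  fixes f :: "real \<Rightarrow> real"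
  assumes "mono_on A f" "A \<in> sets borel"
  shows "set_borel_measurable lborel A f"
  using borel_measurable_mono_on_fnc[OF assms(1)] assms(2)
  unfolding set_borel_measurable_def
  by (subst (asm) borel_measurable_restrict_space_iff) auto

lemma LINT_Ioo_eq_integral:
  fixes f :: "real \<Rightarrow> real"
  assumes "set_integrable lborel {a<..<b} f" "a \<le> s" "s \<le> b"
  shows "f integrable_on {a..s}" "(LINT t:{a<..<s}|lborel. f t) = integral {a..s} f"
proof -
  have "set_integrable lborel {a<..<s} f"
    using assms by (auto intro: set_integrable_subset[OF assms(1)])
  from set_borel_integral_eq_integral[OF this]
  show "f integrable_on {a..s}" "(LINT t:{a<..<s}|lborel. f t) = integral {a..s} f"
    by (auto simp: integrable_on_Icc_iff_Ioo integral_open_interval_real)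
qed

lemma continuous_on_LINT_Ioo:
  fixes f :: "real \<Rightarrow> real"
  assumes f: "set_integrable lborel {a<..<b} f"
  shows "continuous_on {a..b} (\<lambda>s. LINT t:{a<..<s}|lborel. f t)"
proof (cases "a \<le> b")
  case True
  have "continuous_on {a..b} (\<lambda>s. integral {a..s} f)"
    by (rule indefinite_integral_continuous_1) (use LINT_Ioo_eq_integral(1)[OF f True] in simp)
  then show ?thesis
    by (rule continuous_on_eq) (simp add: LINT_Ioo_eq_integral(2)[OF f])
qed simp

lemma LINT_Ioo_split:
  fixes f :: "real \<Rightarrow> real"
  assumes f: "set_integrable lborel {a<..<b} f" and "a < x" "x \<le> y" "y \<le> b"
  shows "(LINT t:{a<..<y}|lborel. f t) = (LINT t:{a<..<x}|lborel. f t) + (LINT t:{x..<y}|lborel. f t)"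
proof -
  have "{a<..<y} = {a<..<x} \<union> {x..<y}" using assms by auto
  moreover have "(LINT t:{a<..<x} \<union> {x..<y}|lborel. f t) = (LINT t:{a<..<x}|lborel. f t) + (LINT t:{x..<y}|lborel. f t)"
    using assms by (intro set_integral_Un) (auto intro: set_integrable_subset[OF f])
  ultimately show ?thesis by simp
qed

text \<open>The left derivative may be unbounded at both ends. Subtracting its value at the midpoint
  gives it a constant sign on each half, where \<open>set_integrable_nonneg_antideriv\<close>
  applies.\<close>

lemma convex_left_deriv_integrable:
  fixes H :: "real \<Rightarrow> real"
  assumes conv: "convex_on {a..b} H" and cont: "continuous_on {a..b} H"
  shows "set_integrable lborel {a<..<b} (left_deriv H)"
proof (cases "a < b")
  case True
  let ?d = "left_deriv H"
  define c where "c = (a + b) / 2"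
  have c: "a < c" "c < b" using True by (auto simp: c_def)
  note mono = convex_left_deriv_mono[OF conv]
  have const: "set_integrable lborel {x..y} (\<lambda>_. k)" "(LINT t:{x..y}|lborel. k) = k * (y - x)"
    if "x \<le> y" for x y k :: real
    using that by (auto intro!: borel_integrable_atLeastAtMost' simp: set_lebesgue_integral_def)
  have const': "set_integrable lborel {x<..<y} (\<lambda>_. k)" for x y k :: real
    by (rule set_integrable_subset[OF set_integrable_mono_on_Icc[of x y]]) (auto simp: mono_on_def)
  have up: "set_integrable lborel {c<..<b} (\<lambda>t. ?d t - ?d c)"
  proof (rule set_integrable_nonneg_antideriv)
    show "continuous_on {c..b} (\<lambda>t. H t - ?d c * t)"
      using c by (intro continuous_intros continuous_on_subset[OF cont]) auto
    show "set_borel_measurable lborel {c<..<b} (\<lambda>t. ?d t - ?d c)"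
      using c by (intro set_borel_measurable_mono_on) (auto intro!: mono_onI mono_onD[OF mono])
    show "0 \<le> ?d t - ?d c" if "c < t" "t < b" for t
      using mono_onD[OF mono, of c t] that c by auto
    fix x y assume xy: "c < x" "x < y" "y < b"
    note F = convex_left_deriv_FTC[OF conv, of x y]
    show "set_integrable lborel {x..y} (\<lambda>t. ?d t - ?d c)"
      using xy c by (intro set_integral_diff F const) auto
    show "(LINT t:{x..y}|lborel. ?d t - ?d c) = H y - ?d c * y - (H x - ?d c * x)"
      using xy c by (subst set_integral_diff) (auto simp: F const algebra_simps)
  qed (use c in auto)
  have lo: "set_integrable lborel {a<..<c} (\<lambda>t. ?d c - ?d t)"
  proof (rule set_integrable_nonneg_antideriv)
    show "continuous_on {a..c} (\<lambda>t. ?d c * t - H t)"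
      using c by (intro continuous_intros continuous_on_subset[OF cont]) auto
    have "set_borel_measurable lborel {a<..<c} (\<lambda>t. ?d t - ?d c)"
      using c by (intro set_borel_measurable_mono_on) (auto intro!: mono_onI mono_onD[OF mono])
    then have "(\<lambda>t. - (indicator {a<..<c} t *\<^sub>R (?d t - ?d c))) \<in> borel_measurable lborel"
      unfolding set_borel_measurable_def by (rule borel_measurable_uminus)
    moreover have eq: "(\<lambda>t. indicator {a<..<c} t *\<^sub>R (?d c - ?d t)) = (\<lambda>t. - (indicator {a<..<c} t *\<^sub>R (?d t - ?d c)))"
      by (auto simp: fun_eq_iff algebra_simps)
    ultimately show "set_borel_measurable lborel {a<..<c} (\<lambda>t. ?d c - ?d t)"
      unfolding set_borel_measurable_def eq by blast
    show "0 \<le> ?d c - ?d t" if "a < t" "t < c" for t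
      using mono_onD[OF mono, of t c] that c by auto
    fix x y assume xy: "a < x" "x < y" "y < c"
    note F = convex_left_deriv_FTC[OF conv, of x y]
    show "set_integrable lborel {x..y} (\<lambda>t. ?d c - ?d t)"
      using xy c by (intro set_integral_diff F const) auto
    show "(LINT t:{x..y}|lborel. ?d c - ?d t) = ?d c * y - H y - (?d c * x - H x)"
      using xy c by (subst set_integral_diff) (auto simp: F const algebra_simps)
  qed (use c in auto)
  have "set_integrable lborel {c<..<b} (\<lambda>t. (?d t - ?d c) + ?d c)"
    by (intro set_integral_add(1) up const')
  moreover have "set_integrable lborel {a<..<c} (\<lambda>t. ?d c - (?d c - ?d t))"
    by (intro set_integral_diff(1) lo const')
  \<comment> \<open>The degenerate interval supplies the midpoint missing from the two open
    halves.\<close>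
  moreover have "set_integrable lborel {c..c} ?d"
    using c by (intro convex_left_deriv_FTC[OF conv]) auto
  ultimately have "set_integrable lborel (({a<..<c} \<union> {c..c}) \<union> {c<..<b}) ?d"
    by (intro set_integrable_Un) auto
  moreover have "({a<..<c} \<union> {c..c}) \<union> {c<..<b} = {a<..<b}" using c by auto
  ultimately show ?thesis by simp
qed (simp add: set_integrable_def)

text \<open>The compact case makes the difference \<open>?\<Psi>\<close> constant on the open
  interval; continuity carries this to the endpoints.\<close>

lemma convex_left_deriv_integral:
  fixes H :: "real \<Rightarrow> real"
  assumes conv: "convex_on {a..b} H" and cont: "continuous_on {a..b} H" and s: "a \<le> s" "s \<le> b"
  shows "(LINT t:{a<..<s}|lborel. left_deriv H t) = H s - H a"
proof (cases "a < b")
  case True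
  let ?I = "\<lambda>s. LINT t:{a<..<s}|lborel. left_deriv H t"
  let ?\<Psi> = "\<lambda>s. ?I s - H s"
  define c where "c = (a + b) / 2"
  have c: "a < c" "c < b" using True by (auto simp: c_def)
  note int = convex_left_deriv_integrable[OF conv cont]
  have cts: "continuous_on {a..b} ?\<Psi>"
    by (intro continuous_intros continuous_on_LINT_Ioo int cont)
  have diff: "?\<Psi> y = ?\<Psi> x" if "a < x" "x \<le> y" "y < b" for x y
  proof -
    have meas: "set_borel_measurable lborel A (left_deriv H)" if "A \<subseteq> {x..y}" "A \<in> sets borel" for A
      using that \<open>a < x\<close> \<open>y < b\<close>
      by (intro set_borel_measurable_mono_on mono_on_subset[OF convex_left_deriv_mono[OF conv]]) auto
    have "(LINT t:{x..<y}|lborel. left_deriv H t) = (LINT t:{x..y}|lborel. left_deriv H t)"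
    proof (rule set_integral_cong_set)
      show "AE t in lborel. (t \<in> {x..y}) = (t \<in> {x..<y})"
        using AE_lborel_singleton[of y] by eventually_elim auto
    qed (auto intro!: meas)
    then show ?thesis
      using LINT_Ioo_split[OF int, of x y] convex_left_deriv_FTC(2)[OF conv, of x y] that by simp
  qed
  have const: "?\<Psi> x = ?\<Psi> c" if "x \<in> {a<..<b}" for x
  proof (cases "x \<le> c")
    case True
    show ?thesis by (rule diff[symmetric]) (use True that c in auto)
  next
    case False
    show ?thesis by (rule diff) (use False that c in auto)
  qed
  have cl: "{a..b} = closure {a<..<b}" using True by simp
  have all: "?\<Psi> x = ?\<Psi> c" if "x \<in> {a..b}" for x
  proof (rule continuous_constant_on_closure[where S="{a<..<b}" and f="?\<Psi>"])
    show "continuous_on (closure {a<..<b}) ?\<Psi>" unfolding cl[symmetric] by (rule cts)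
    show "x \<in> closure {a<..<b}" unfolding cl[symmetric] by (rule that)
  qed (rule const)
  have s': "s \<in> {a..b}" using s by simp
  have "?\<Psi> s = ?\<Psi> a"
    by (rule trans[OF all[OF s'] all[symmetric]]) (use True in simp)
  moreover have "?I a = 0" by (simp add: set_lebesgue_integral_def)
  ultimately show ?thesis by linarith
next
  case False
  then have "s = a" using s by simp
  then show ?thesis by (simp add: set_lebesgue_integral_def)
qed

section \<open>Convex envelopes\<close>

text \<open>A convex function falls up to a minimizer \<open>m\<close> and rises after it. This is
  needed because membership in \<open>distortions\<close> demands bounded variation of every
  candidate minorant.\<close>

lemma convex_continuous_bounded_variation:
  fixes f :: "real \<Rightarrow> real"
  assumes conv: "convex_on {a..b} f" and cont: "continuous_on {a..b} f"
  shows "bounded_variation_on f {a..b}"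
proof (cases "a \<le> b")
  case True
  then obtain m where m: "m \<in> {a..b}" "\<And>x. x \<in> {a..b} \<Longrightarrow> f m \<le> f x"
    using continuous_attains_inf[OF compact_Icc _ cont] by auto
  have dec: "f y \<le> f x" if "a \<le> x" "x \<le> y" "y \<le> m" for x y
  proof -
    have "f y \<le> (f m - f x) / (m - x) * (y - x) + f x"
      using that m(1) by (intro convex_onD_Icc' convex_on_subset[OF conv]) auto
    moreover have "(f m - f x) / (m - x) * (y - x) \<le> 0"
      using m that by (intro mult_nonpos_nonneg divide_nonpos_nonneg) auto
    ultimately show ?thesis by linarith
  qed
  have inc: "f y \<le> f z" if "m \<le> y" "y \<le> z" "z \<le> b" for y z
  proof -
    have "f y \<le> (f m - f z) / (z - m) * (z - y) + f z"
      using that m(1) by (intro convex_onD_Icc'' convex_on_subset[OF conv]) auto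
    moreover have "(f m - f z) / (z - m) * (z - y) \<le> 0"
      using m that by (intro mult_nonpos_nonneg divide_nonpos_nonneg) auto
    ultimately show ?thesis by linarith
  qed
  \<comment> \<open>On the interval \<open>p\<close> is nondecreasing, \<open>n\<close> is
    nonincreasing and \<open>f = p + n - f m\<close>, so the absolute increments are dominated by
    two telescoping sums.\<close>
  define p where "p x = f (max x m)" for x
  define n where "n x = f (min x m)" for x
  have bound: "(\<Sum>i<k. \<bar>f (x (Suc i)) - f (x i)\<bar>) \<le> (f b - f m) + (f a - f m)"
    if x: "mono x" "\<And>i. x i \<in> {a..b}" for k and x :: "nat \<Rightarrow> real"
  proof -
    have "(\<Sum>i<k. \<bar>f (x (Suc i)) - f (x i)\<bar>)
        \<le> (\<Sum>i<k. (p (x (Suc i)) - p (x i)) + (n (x i) - n (x (Suc i))))"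
    proof (rule sum_mono)
      fix i
      have le: "x i \<le> x (Suc i)" using x(1) by (simp add: monoD)
      have dec2: "p (x i) \<le> p (x (Suc i))" "n (x (Suc i)) \<le> n (x i)"
        unfolding p_def n_def using le x(2)[of i] x(2)[of "Suc i"] m(1)
        by (intro inc dec; auto)+
      have "f y = p y + n y - f m" for y
        by (auto simp: p_def n_def max_def min_def)
      from this[of "x i"] this[of "x (Suc i)"]
      have "f (x (Suc i)) - f (x i) = (p (x (Suc i)) - p (x i)) - (n (x i) - n (x (Suc i)))"
        by linarith
      with dec2 show "\<bar>f (x (Suc i)) - f (x i)\<bar> \<le> (p (x (Suc i)) - p (x i)) + (n (x i) - n (x (Suc i)))"
        by linarith
    qed
    also have "\<dots> = (p (x k) - p (x 0)) + (n (x 0) - n (x k))"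
      by (simp add: sum.distrib sum_lessThan_telescope[of "\<lambda>i. p (x i)"] sum_lessThan_telescope'[of "\<lambda>i. n (x i)"])
    also have "\<dots> \<le> (f b - f m) + (f a - f m)"
    proof -
      have "p (x k) \<le> f b" "f m \<le> p (x 0)" "n (x 0) \<le> f a" "f m \<le> n (x k)"
        unfolding p_def n_def using x(2)[of k] x(2)[of 0] m(1)
        by (intro inc dec m(2); auto)+
      then show ?thesis by linarith
    qed
    finally show ?thesis .
  qed
  then show ?thesis
    unfolding bounded_variation_on_def by blast
qed (simp add: bounded_variation_on_def)

definition convex_minorants :: "(real \<Rightarrow> real) \<Rightarrow> (real \<Rightarrow> real) set" where
  "convex_minorants f = {k \<in> distortions. convex_on {0..1} k \<and> (\<forall>s\<in>{0..1}. k s \<le> f s)}"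

lemma convex_env_eq: "convex_env f t = (SUP k\<in>convex_minorants f. k t)"
  unfolding convex_env_def convex_minorants_def by (intro arg_cong[where f = Sup]) auto

lemma distortionsI_convex:
  assumes "convex_on {0..1} k" "continuous_on {0..1} k" "k 0 = 0"
  shows "k \<in> distortions"
  using assms by (simp add: distortions_def convex_continuous_bounded_variation)

text \<open>Within distance \<open>r\<close> of \<open>c\<close> continuity keeps \<open>f\<close>
  above \<open>f c - \<delta>\<close>; farther away the slope \<open>M\<close> has brought the cone
  below the minimum of \<open>f\<close>. When \<open>c\<close> is an endpoint, the cone is affine on
  the interval.\<close>

lemma endpoint_cone_minorant:
  fixes f :: "real \<Rightarrow> real"
  assumes cont: "continuous_on {a..b} f" and c: "c \<in> {a..b}" and \<delta>: "0 < \<delta>"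
  obtains M where "0 \<le> M" "\<And>t. t \<in> {a..b} \<Longrightarrow> f c - \<delta> - M * \<bar>t - c\<bar> \<le> f t"
proof -
  obtain r where r: "r > 0" "\<And>t. t \<in> {a..b} \<Longrightarrow> dist t c < r \<Longrightarrow> dist (f t) (f c) < \<delta>"
    using cont c \<delta> unfolding continuous_on_iff by metis
  have "{a..b} \<noteq> {}" using c by auto
  from continuous_attains_inf[OF compact_Icc this cont] obtain m where m: "\<And>t. t \<in> {a..b} \<Longrightarrow> f m \<le> f t"
    by blast
  define M where "M = (f c - f m) / r"
  have M: "0 \<le> M" using m[OF c] r(1) by (simp add: M_def)
  have "f c - \<delta> - M * \<bar>t - c\<bar> \<le> f t" if t: "t \<in> {a..b}" for t
  proof (cases "dist t c < r")
    case True
    then have "f c - \<delta> < f t" using r(2)[OF t] by (auto simp: dist_real_def)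
    moreover have "0 \<le> M * \<bar>t - c\<bar>" using M by simp
    ultimately show ?thesis by linarith
  next
    case False
    then have "M * r \<le> M * \<bar>t - c\<bar>"
      using M by (intro mult_left_mono) (auto simp: dist_real_def)
    then show ?thesis using m[OF t] \<delta> r(1) by (simp add: M_def)
  qed
  with M show ?thesis by (rule that)
qed

text \<open>The cone condition says that \<open>k\<close> is squeezed onto \<open>f\<close> at the endpoints.\<close>

lemma convex_squeezed_at_endpoints:
  fixes f k :: "real \<Rightarrow> real"
  assumes f: "continuous_on {0..1} f" and conv: "convex_on {0..1} k"
    and le: "\<And>t. t \<in> {0..1} \<Longrightarrow> k t \<le> f t"
    and cone: "\<And>c \<delta>. c \<in> {0, 1} \<Longrightarrow> 0 < \<delta> \<Longrightarrow> \<exists>M. \<forall>t\<in>{0..1}. f c - \<delta> - M * \<bar>t - c\<bar> \<le> k t"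
  shows "continuous_on {0..1} k" and "k 0 = f 0" and "k 1 = f 1"
proof -
  have eq: "k c = f c" if c: "c \<in> {0, 1}" for c
  proof (rule antisym)
    show "k c \<le> f c" using le c by auto
    show "f c \<le> k c"
    proof (rule field_le_epsilon)
      fix \<delta> :: real assume "0 < \<delta>"
      then obtain M where "\<forall>t\<in>{0..1}. f c - \<delta> - M * \<bar>t - c\<bar> \<le> k t"
        using cone[OF c] by blast
      moreover have "c \<in> {0..1}" using c by auto
      ultimately have "f c - \<delta> - M * \<bar>c - c\<bar> \<le> k c" by blast
      then show "f c \<le> k c + \<delta>" by simp
    qed
  qed
  then show "k 0 = f 0" "k 1 = f 1" by auto
  have "continuous (at c within {0..1}) k" if c: "c \<in> {0..1}" for c
  proof (cases "c \<in> {0, 1}")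
    case True
    have lim_f: "(f \<longlongrightarrow> f c) (at c within {0..1})"
      using f c by (simp add: continuous_on_def)
    have dom: "\<forall>\<^sub>F t in at c within {0..1}. t \<in> {0..1}"
      by (simp add: eventually_at_filter)
    show ?thesis
      unfolding continuous_within eq[OF True]
    proof (rule order_tendstoI)
      fix l assume "l < f c"
      define \<delta> where "\<delta> = (f c - l) / 2"
      have \<delta>: "0 < \<delta>" "l < f c - \<delta> - M * \<bar>c - c\<bar>" for M
        using \<open>l < f c\<close> by (auto simp: \<delta>_def field_simps)
      obtain M where M: "\<forall>t\<in>{0..1}. f c - \<delta> - M * \<bar>t - c\<bar> \<le> k t"
        using cone[OF True \<delta>(1)] by blast
      have "((\<lambda>t. f c - \<delta> - M * \<bar>t - c\<bar>) \<longlongrightarrow> f c - \<delta> - M * \<bar>c - c\<bar>) (at c within {0..1})"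
        by (intro tendsto_intros)
      from order_tendstoD(1)[OF this \<delta>(2)] dom
      show "\<forall>\<^sub>F t in at c within {0..1}. l < k t"
        by eventually_elim (use M in force)
    next
      fix u assume "f c < u"
      from order_tendstoD(2)[OF lim_f this] dom
      show "\<forall>\<^sub>F t in at c within {0..1}. k t < u"
        by eventually_elim (use le in force)
    qed
  next
    case False
    then have "c \<in> {0<..<1}" using c by auto
    then have "isCont k c"
      using convex_on_continuous_interior[OF conv] by (simp add: continuous_on_eq_continuous_at)
    then show ?thesis
      by (rule continuous_at_imp_continuous_at_within)
  qed
  then show "continuous_on {0..1} k"
    by (simp add: continuous_on_eq_continuous_within)
qed

lemma convex_on_SUP:
  fixes f :: "'i \<Rightarrow> 'a::real_vector \<Rightarrow> real"
  assumes "I \<noteq> {}" and "\<And>x. x \<in> A \<Longrightarrow> bdd_above ((\<lambda>i. f i x) ` I)"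
    and conv: "\<And>i. i \<in> I \<Longrightarrow> convex_on A (f i)" and A: "convex A"
  shows "convex_on A (\<lambda>x. SUP i\<in>I. f i x)"
proof (rule convex_onI[OF _ A])
  fix t :: real and x y assume t: "0 < t" "t < 1" and xy: "x \<in> A" "y \<in> A"
  show "(SUP i\<in>I. f i ((1 - t) *\<^sub>R x + t *\<^sub>R y)) \<le> (1 - t) * (SUP i\<in>I. f i x) + t * (SUP i\<in>I. f i y)"
  proof (rule cSUP_least[OF assms(1)])
    fix i assume i: "i \<in> I"
    have "f i ((1 - t) *\<^sub>R x + t *\<^sub>R y) \<le> (1 - t) * f i x + t * f i y"
      using convex_onD[OF conv[OF i]] t xy by simp
    also have "\<dots> \<le> (1 - t) * (SUP i\<in>I. f i x) + t * (SUP i\<in>I. f i y)"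
      using t xy assms(2) i by (intro add_mono mult_left_mono cSUP_upper) auto
    finally show "f i ((1 - t) *\<^sub>R x + t *\<^sub>R y) \<le> (1 - t) * (SUP i\<in>I. f i x) + t * (SUP i\<in>I. f i y)" .
  qed
qed

lemma convex_on_affine: "convex A \<Longrightarrow> convex_on A (\<lambda>x. \<alpha> + \<beta> * x)" for \<alpha> \<beta> :: real
  by (rule convex_onI) (auto simp: algebra_simps)

text \<open>The supremum of all affine minorants works: the cones at 0 and 1 are affine on the unit
  interval and force it up to \<open>f\<close> there. Its existence makes the supremum in
  \<open>convex_env\<close> one over a nonempty set and fixes the value at 1.\<close>

lemma convex_minorant_exists:
  fixes f :: "real \<Rightarrow> real"
  assumes f: "continuous_on {0..1} f" "f 0 = 0"
  obtains k where "k \<in> convex_minorants f" "k 1 = f 1"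
proof -
  define A where "A = {(\<alpha>, \<beta>). \<forall>s\<in>{0..1}. \<alpha> + \<beta> * s \<le> f s}"
  define k where "k t = (SUP (\<alpha>, \<beta>)\<in>A. \<alpha> + \<beta> * t)" for t
  have bdd: "bdd_above ((\<lambda>(\<alpha>, \<beta>). \<alpha> + \<beta> * t) ` A)" if "t \<in> {0..1}" for t
    using that by (intro bdd_aboveI[of _ "f t"]) (auto simp: A_def)
  have cone: "\<exists>M. \<forall>t\<in>{0..1}. f c - \<delta> - M * \<bar>t - c\<bar> \<le> k t" if c: "c \<in> {0, 1}" and \<delta>: "0 < \<delta>" for c \<delta>
  proof -
    have "c \<in> {0..1}" using c by auto
    then obtain M where M: "\<And>t. t \<in> {0..1} \<Longrightarrow> f c - \<delta> - M * \<bar>t - c\<bar> \<le> f t"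
      using endpoint_cone_minorant[OF f(1) _ \<delta>] by metis
    obtain \<alpha> \<beta> where ab: "\<And>t. t \<in> {0..1} \<Longrightarrow> f c - \<delta> - M * \<bar>t - c\<bar> = \<alpha> + \<beta> * t"
    proof (cases "c = 0")
      case True
      show ?thesis by (rule that[of "f c - \<delta>" "- M"]) (use True in auto)
    next
      case False
      show ?thesis by (rule that[of "f c - \<delta> - M" "M"]) (use False c in \<open>auto simp: algebra_simps\<close>)
    qed
    then have "(\<alpha>, \<beta>) \<in> A" using M by (auto simp: A_def)
    then have "\<alpha> + \<beta> * t \<le> k t" if "t \<in> {0..1}" for t
      unfolding k_def using cSUP_upper[OF _ bdd[OF that]] by fastforce
    with ab show ?thesis by (intro exI[of _ M]) auto
  qed
  have ne: "A \<noteq> {}"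
  proof -
    have "{0..1::real} \<noteq> {}" by auto
    from continuous_attains_inf[OF compact_Icc this f(1)] obtain m where "\<And>t. t \<in> {0..1} \<Longrightarrow> f m \<le> f t"
      by blast
    then have "(f m, 0) \<in> A" by (simp add: A_def)
    then show ?thesis by blast
  qed
  have le: "k t \<le> f t" if "t \<in> {0..1}" for t
    unfolding k_def using ne that by (intro cSUP_least) (auto simp: A_def)
  have conv: "convex_on {0..1} k"
    unfolding k_def by (rule convex_on_SUP) (use ne bdd in \<open>auto intro!: convex_on_affine\<close>)
  note sq = convex_squeezed_at_endpoints[OF f(1) conv le cone]
  have "k \<in> convex_minorants f"
    unfolding convex_minorants_def using sq f(2) le conv by (auto intro: distortionsI_convex)
  then show ?thesis by (rule that) (rule sq)
qed

text \<open>The endpoint behaviour is inherited from the minorant \<open>k\<close> that agrees with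
  \<open>f\<close> at 0 and 1: being continuous, \<open>k\<close> lies above cones of its own, and
  the envelope dominates \<open>k\<close>.\<close>

lemma
  fixes f :: "real \<Rightarrow> real"
  assumes f: "continuous_on {0..1} f" "f 0 = 0"
  shows convex_env_le: "t \<in> {0..1} \<Longrightarrow> convex_env f t \<le> f t"
    and convex_env_greatest: "k \<in> convex_minorants f \<Longrightarrow> t \<in> {0..1} \<Longrightarrow> k t \<le> convex_env f t"
    and convex_env_convex: "convex_on {0..1} (convex_env f)"
    and convex_env_continuous: "continuous_on {0..1} (convex_env f)"
    and convex_env_0: "convex_env f 0 = 0"
    and convex_env_1: "convex_env f 1 = f 1"
proof -
  obtain k where k: "k \<in> convex_minorants f" "k 1 = f 1"
    using convex_minorant_exists[OF f] .
  have bdd: "bdd_above ((\<lambda>k. k t) ` convex_minorants f)" if "t \<in> {0..1}" for t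
    using that by (intro bdd_aboveI[of _ "f t"]) (auto simp: convex_minorants_def)
  show le: "convex_env f t \<le> f t" if "t \<in> {0..1}" for t
    unfolding convex_env_eq using k(1) that by (intro cSUP_least) (auto simp: convex_minorants_def)
  show gr: "k t \<le> convex_env f t" if "k \<in> convex_minorants f" "t \<in> {0..1}" for k t
    unfolding convex_env_eq using that by (intro cSUP_upper bdd)
  show conv: "convex_on {0..1} (convex_env f)"
    unfolding convex_env_eq[abs_def]
    by (rule convex_on_SUP) (use k(1) bdd in \<open>auto simp: convex_minorants_def\<close>)
  have cone: "\<exists>M. \<forall>t\<in>{0..1}. f c - \<delta> - M * \<bar>t - c\<bar> \<le> convex_env f t" if c: "c \<in> {0, 1}" and \<delta>: "0 < \<delta>" for c \<delta>
  proof -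
    have cont: "continuous_on {0..1} k" and c': "c \<in> {0..1}"
      using k(1) c by (auto simp: convex_minorants_def distortions_def)
    obtain M where "\<And>t. t \<in> {0..1} \<Longrightarrow> k c - \<delta> - M * \<bar>t - c\<bar> \<le> k t"
      using endpoint_cone_minorant[OF cont c' \<delta>] by metis
    moreover have "k c = f c"
      using k f(2) c by (auto simp: convex_minorants_def distortions_def)
    ultimately show ?thesis using gr[OF k(1)] by (metis order_trans)
  qed
  from convex_squeezed_at_endpoints[OF f(1) conv le cone] f(2)
  show "continuous_on {0..1} (convex_env f)" "convex_env f 0 = 0" "convex_env f 1 = f 1"
    by auto
qed

lemma convex_on_max:
  fixes f g :: "'a::real_vector \<Rightarrow> real"
  assumes "convex_on A f" "convex_on A g"
  shows "convex_on A (\<lambda>x. max (f x) (g x))"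
proof (rule convex_onI)
  show "convex A" using assms(1) by (rule convex_on_imp_convex)
  fix t :: real and x y assume t: "0 < t" "t < 1" and xy: "x \<in> A" "y \<in> A"
  have "f ((1 - t) *\<^sub>R x + t *\<^sub>R y) \<le> (1 - t) * f x + t * f y"
    "g ((1 - t) *\<^sub>R x + t *\<^sub>R y) \<le> (1 - t) * g x + t * g y"
    using convex_onD[OF assms(1)] convex_onD[OF assms(2)] t xy by auto
  moreover have "(1 - t) * f x \<le> (1 - t) * max (f x) (g x)" "t * f y \<le> t * max (f y) (g y)"
    "(1 - t) * g x \<le> (1 - t) * max (f x) (g x)" "t * g y \<le> t * max (f y) (g y)"
    using t by (auto intro!: mult_left_mono)
  ultimately show "max (f ((1 - t) *\<^sub>R x + t *\<^sub>R y)) (g ((1 - t) *\<^sub>R x + t *\<^sub>R y))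
      \<le> (1 - t) * max (f x) (g x) + t * max (f y) (g y)"
    by linarith
qed

text \<open>Replacing the envelope by its chord over a short interval around \<open>t\<close> gives another convex
  minorant, so the envelope already agrees with the chord there.\<close>

lemma convex_env_locally_affine:
  fixes f :: "real \<Rightarrow> real"
  assumes f: "continuous_on {0..1} f" "f 0 = 0"
    and t: "0 < t" "t < 1" and lt: "convex_env f t < f t"
  obtains \<delta> \<alpha> \<beta> where "0 < \<delta>" "0 < t - \<delta>" "t + \<delta> < 1"
    "\<And>s. s \<in> {t-\<delta>..t+\<delta>} \<Longrightarrow> convex_env f s = \<alpha> + \<beta> * s"
proof -
  let ?e = "convex_env f"
  note conv = convex_env_convex[OF f] and cont = convex_env_continuous[OF f]
  \<comment> \<open>A level separating the two functions near \<open>t\<close>: the ends of the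
    chord, and so the chord, will lie below \<open>m\<close>, while \<open>f\<close> stays above
    it.\<close>
  define m where "m = (?e t + f t) / 2"
  have m: "?e t < m" "m < f t" using lt by (auto simp: m_def)
  have "isCont f t" "isCont ?e t"
    using f(1) cont t by (auto intro: continuous_on_interior)
  then have "\<forall>\<^sub>F s in nhds t. ?e s < m" "\<forall>\<^sub>F s in nhds t. m < f s"
    using m by (auto intro: order_tendstoD simp: isCont_def tendsto_nhds_iff)
  moreover have "\<forall>\<^sub>F s in nhds t. s \<in> {0<..<1}"
    using t by (intro eventually_nhds_in_open) auto
  ultimately have "\<forall>\<^sub>F s in nhds t. ?e s < m \<and> m < f s \<and> s \<in> {0<..<1}"
    by eventually_elim auto
  then obtain r where r: "r > 0" "\<And>s. dist s t < r \<Longrightarrow> ?e s < m \<and> m < f s \<and> s \<in> {0<..<1}"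
    unfolding eventually_nhds_metric by auto
  define \<delta> where "\<delta> = r / 2"
  have \<delta>: "0 < \<delta>" using r(1) by (simp add: \<delta>_def)
  have near: "?e s < m" "m < f s" "0 < s" "s < 1" if "s \<in> {t-\<delta>..t+\<delta>}" for s
    using r(2)[of s] that r(1) by (auto simp: dist_real_def \<delta>_def)
  define a b where "a = t - \<delta>" and "b = t + \<delta>"
  have ab: "a < b" "0 < a" "b < 1"
    using near[of a] near[of b] \<delta> by (auto simp: a_def b_def)
  define \<beta> where "\<beta> = (?e b - ?e a) / (b - a)"
  define L where "L s = (?e a - \<beta> * a) + \<beta> * s" for s
  have La: "L a = ?e a" by (simp add: L_def)
  have Lb: "L b = ?e b"
  proof -
    have "\<beta> * (b - a) = ?e b - ?e a" using ab by (simp add: \<beta>_def)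
    then show ?thesis by (simp add: L_def algebra_simps)
  qed
  have in_chord: "?e s \<le> L s" if "s \<in> {a..b}" for s
  proof -
    have "convex_on {a..b} ?e"
      by (rule convex_on_subset[OF conv]) (use ab in auto)
    from convex_onD_Icc'[OF this that] have "?e s \<le> \<beta> * (s - a) + ?e a"
      unfolding \<beta>_def .
    then show ?thesis by (simp add: L_def algebra_simps)
  qed
  have below: "L s < f s" if s: "s \<in> {a..b}" for s
  proof -
    have "L s \<le> max (L a) (L b)"
    proof (cases "0 \<le> \<beta>")
      case True
      then have "\<beta> * s \<le> \<beta> * b" using s by (intro mult_left_mono) auto
      then show ?thesis by (simp add: L_def)
    next
      case False
      then have "\<beta> * s \<le> \<beta> * a" using s by (intro mult_left_mono_neg) auto
      then show ?thesis by (simp add: L_def)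
    qed
    also have "\<dots> < m"
      using near(1)[of a] near(1)[of b] \<delta> unfolding La Lb by (auto simp: a_def b_def)
    finally show ?thesis using near(2)[of s] s by (auto simp: a_def b_def)
  qed
  \<comment> \<open>Beyond the interval the extended chord lies below the convex function
    \<open>?e\<close>, so taking the maximum \<open>k\<close> changes nothing there, in particular
    at 0.\<close>
  have outside: "L s \<le> ?e s" if s: "s \<in> {0..1}" "s \<notin> {a..b}" for s
  proof (cases "s < a")
    case True
    have "(?e a - ?e s) / (a - s) \<le> \<beta>"
      unfolding \<beta>_def using convex_slope_le_slope[OF conv, of s b a] s True ab by auto
    then have "?e a - ?e s \<le> \<beta> * (a - s)"
      using True by (simp add: divide_le_eq)
    then show ?thesis by (simp add: L_def algebra_simps)
  next
    case False
    then have "b < s" using s by auto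
    then have "\<beta> \<le> (?e s - ?e b) / (s - b)"
      unfolding \<beta>_def using convex_slope_le_slope[OF conv, of a s b] s ab by auto
    then have "\<beta> * (s - b) \<le> ?e s - ?e b"
      using \<open>b < s\<close> by (simp add: le_divide_eq)
    then show ?thesis using Lb by (simp add: L_def algebra_simps)
  qed
  define k where "k s = max (?e s) (L s)" for s
  have "k \<in> convex_minorants f"
  proof -
    have "convex_on {0..1} k"
      unfolding k_def L_def by (intro convex_on_max conv convex_on_affine) auto
    moreover have "continuous_on {0..1} k"
      unfolding k_def L_def by (intro continuous_intros cont)
    moreover have "k 0 = 0"
      using outside[of 0] convex_env_0[OF f] ab by (simp add: k_def)
    moreover have "k s \<le> f s" if "s \<in> {0..1}" for s
      using convex_env_le[OF f that] outside[OF that] below[of s] unfolding k_def by force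
    ultimately show ?thesis
      by (auto simp: convex_minorants_def intro: distortionsI_convex)
  qed
  then have "L s \<le> ?e s" if "s \<in> {a..b}" for s
    using convex_env_greatest[OF f, of k s] that ab by (auto simp: k_def)
  with in_chord have eq: "?e s = L s" if "s \<in> {a..b}" for s
    using that by (meson antisym)
  show ?thesis
  proof (rule that[OF \<delta>])
    show "0 < t - \<delta>" "t + \<delta> < 1" using ab by (auto simp: a_def b_def)
    show "?e s = (?e a - \<beta> * a) + \<beta> * s" if "s \<in> {t-\<delta>..t+\<delta>}" for s
      using eq[of s] that unfolding L_def a_def b_def by blast
  qed
qed

lemma left_deriv_locally_affine:
  fixes f :: "real \<Rightarrow> real"
  assumes "a < x" "x \<le> b" and eq: "\<And>s. s \<in> {a..b} \<Longrightarrow> f s = \<alpha> + \<beta> * s"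
  shows "left_deriv f x = \<beta>"
proof (rule has_left_deriv_unique)
  have "((\<lambda>s. \<alpha> + \<beta> * s) has_real_derivative \<beta>) (at_left x)"
    by (auto intro!: derivative_eq_intros)
  moreover have "\<forall>\<^sub>F s in at_left x. f s = \<alpha> + \<beta> * s"
    unfolding eventually_at_left_field using assms by (intro exI[of _ a]) auto
  moreover have "f x = \<alpha> + \<beta> * x"
    using assms by simp
  ultimately show "(f has_real_derivative \<beta>) (at_left x)"
    by (subst has_field_derivative_cong_eventually)
qed

section \<open>Quantile functions\<close>

definition unif :: "real measure" where
  "unif = restrict_space lborel {0<..<1}"

lemma space_unif [simp]: "space unif = {0<..<1}"
  by (simp add: unif_def space_restrict_space)

lemma prob_space_unif: "prob_space unif"
  by (rule prob_spaceI) (simp add: unif_def emeasure_restrict_space space_restrict_space)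

interpretation unif: prob_space unif
  by (rule prob_space_unif)

lemma integrable_unif_iff: "integrable unif f \<longleftrightarrow> set_integrable lborel {0<..<1} f" for f :: "real \<Rightarrow> real"
  unfolding unif_def set_integrable_def by (rule integrable_restrict_space) simp

lemma integral_unif: "integral\<^sup>L unif f = (LINT t:{0<..<1}|lborel. f t)" for f :: "real \<Rightarrow> real"
  unfolding unif_def set_lebesgue_integral_def by (rule integral_restrict_space) simp

lemma borel_measurable_unif_mono_on:
  fixes f :: "real \<Rightarrow> real"
  assumes "mono_on {0<..<1} f"
  shows "f \<in> borel_measurable unif"
  using borel_measurable_mono_on_fnc[OF assms]
  unfolding unif_def measurable_cong_sets[OF sets_restrict_space_cong[OF sets_lborel] refl] .

lemma AE_unif_iff: "(AE t in unif. P t) \<longleftrightarrow> (AE t in lborel. t \<in> {0<..<1} \<longrightarrow> P t)"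
  unfolding unif_def by (rule AE_restrict_space_iff) simp

lemma is_cdf_right_continuous_mono: "is_cdf F \<Longrightarrow> right_continuous_mono F 0 1"
  by (simp add: is_cdf_def right_continuous_mono_def)

lemma quantile_le_iff:
  assumes "is_cdf F" "0 < t" "t < 1"
  shows "quantile F t \<le> z \<longleftrightarrow> t \<le> F z"
proof -
  interpret right_continuous_mono F 0 1
    using assms(1) by (rule is_cdf_right_continuous_mono)
  show ?thesis
    unfolding quantile_def by (rule pseudoinverse[OF assms(2,3), symmetric])
qed

lemma is_cdf_bounds:
  assumes "is_cdf F"
  shows "0 \<le> F z" "F z \<le> 1"
proof -
  have F: "mono F" "(F \<longlongrightarrow> 0) at_bot" "(F \<longlongrightarrow> 1) at_top"
    using assms by (auto simp: is_cdf_def)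
  show "0 \<le> F z"
    by (rule tendsto_upperbound[OF F(2)])
       (use monoD[OF F(1)] in \<open>auto simp: eventually_at_bot_linorder\<close>)
  show "F z \<le> 1"
    by (rule tendsto_lowerbound[OF F(3)])
       (use monoD[OF F(1)] in \<open>auto simp: eventually_at_top_linorder\<close>)
qed

lemma quantile_mono:
  assumes "is_cdf F"
  shows "mono_on {0<..<1} (quantile F)"
proof (rule mono_onI)
  fix s t :: real assume st: "s \<in> {0<..<1}" "t \<in> {0<..<1}" "s \<le> t"
  have "t \<le> F (quantile F t)"
    using quantile_le_iff[OF assms, of t "quantile F t"] st by auto
  then show "quantile F s \<le> quantile F t"
    using quantile_le_iff[OF assms, of s "quantile F t"] st by auto
qed

lemma quantile_left_cont:
  assumes "is_cdf F" "0 < t" "t < 1"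
  shows "(quantile F \<longlongrightarrow> quantile F t) (at_left t)"
proof (rule order_tendstoI)
  fix l assume "l < quantile F t"
  then have "F l < t"
    using quantile_le_iff[OF assms, of l] by auto
  then show "\<forall>\<^sub>F s in at_left t. l < quantile F s"
    unfolding eventually_at_left_field
  proof (intro exI[of _ "max 0 (F l)"] conjI allI impI)
    fix s assume "max 0 (F l) < s" "s < t"
    then show "l < quantile F s"
      using quantile_le_iff[OF assms(1), of s l] assms by auto
  qed (use assms in auto)
next
  fix u assume u: "quantile F t < u"
  show "\<forall>\<^sub>F s in at_left t. quantile F s < u"
    unfolding eventually_at_left_field
  proof (intro exI[of _ 0] conjI allI impI)
    fix s assume "0 < s" "s < t"
    then show "quantile F s < u"
      using mono_onD[OF quantile_mono[OF assms(1)], of s t] assms u by auto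
  qed (use assms in auto)
qed

lemma is_cdf_eqI:
  assumes F: "is_cdf F" and G: "is_cdf G"
    and eq: "\<And>t. t \<in> {0<..<1} \<Longrightarrow> quantile F t = quantile G t"
  shows "F = G"
proof
  fix z
  have iff: "t \<le> F z \<longleftrightarrow> t \<le> G z" if "0 < t" "t < 1" for t
    using quantile_le_iff[OF F that, of z] quantile_le_iff[OF G that, of z] eq[of t] that by auto
  have no: False if "x < y" "0 \<le> x" "y \<le> 1" "\<And>t. 0 < t \<Longrightarrow> t < 1 \<Longrightarrow> t \<le> x \<longleftrightarrow> t \<le> y" for x y :: real
    using that(4)[of "(x + y) / 2"] that(1-3) by auto
  show "F z = G z"
    using no[of "F z" "G z"] no[of "G z" "F z"] iff is_cdf_bounds[OF F, of z] is_cdf_bounds[OF G, of z]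
    by (cases "F z" "G z" rule: linorder_cases) auto
qed

lemma quantile_measurable [measurable]:
  "is_cdf F \<Longrightarrow> quantile F \<in> borel_measurable unif"
  by (rule borel_measurable_unif_mono_on) (rule quantile_mono)

lemma distr_unif_quantile:
  assumes "is_cdf F"
  shows "distr unif borel (quantile F) = interval_measure F"
proof -
  have F: "\<And>x y. x \<le> y \<Longrightarrow> F x \<le> F y" "\<And>a. continuous (at_right a) F"
      "(F \<longlongrightarrow> 0) at_bot" "(F \<longlongrightarrow> 1) at_top"
    using assms by (auto simp: is_cdf_def mono_def)
  interpret cdf_distribution "interval_measure F"
    unfolding cdf_distribution_def using F by (intro real_distribution_interval_measure) auto
  have "cdf (interval_measure F) = F"
    using F by (intro cdf_interval_measure) auto
  then show ?thesis
    using distr_I_eq_M unfolding unif_def quantile_def[abs_def] by simp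
qed

lemma
  assumes F: "is_cdf F"
  shows finite_second_moment_iff: "finite_second_moment F \<longleftrightarrow> integrable unif (\<lambda>t. (quantile F t)\<^sup>2)"
    and cdf_mean_eq: "cdf_mean F = (LINT t|unif. quantile F t)"
    and cdf_variance_eq: "cdf_variance F = (LINT t|unif. (quantile F t - cdf_mean F)\<^sup>2)"
proof -
  note [measurable] = quantile_measurable[OF F]
  show "finite_second_moment F \<longleftrightarrow> integrable unif (\<lambda>t. (quantile F t)\<^sup>2)"
    unfolding finite_second_moment_def distr_unif_quantile[OF F, symmetric]
    by (subst integrable_distr_eq) auto
  show m: "cdf_mean F = (LINT t|unif. quantile F t)"
    unfolding cdf_mean_def distr_unif_quantile[OF F, symmetric]
    by (subst integral_distr) auto
  show "cdf_variance F = (LINT t|unif. (quantile F t - cdf_mean F)\<^sup>2)"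
    unfolding cdf_variance_def cdf_mean_def distr_unif_quantile[OF F, symmetric]
    by (subst integral_distr) auto
qed

text \<open>\<open>F\<close> is the distribution function of \<open>q\<close> under
  \<open>unif\<close>, and \<open>t \<le> F z\<close> is shown equivalent to
  \<open>q t \<le> z\<close>. One direction is monotonicity; for the other, left continuity lets
  \<open>z < q t\<close> persist on an interval left of \<open>t\<close>, so that the set where
  \<open>q\<close> is at most \<open>z\<close> has measure below \<open>t\<close>.\<close>

lemma ex_cdf_with_quantile:
  fixes q :: "real \<Rightarrow> real"
  assumes mono: "mono_on {0<..<1} q"
    and left: "\<And>t. 0 < t \<Longrightarrow> t < 1 \<Longrightarrow> (q \<longlongrightarrow> q t) (at_left t)"
  shows "\<exists>F. is_cdf F \<and> (\<forall>t\<in>{0<..<1}. quantile F t = q t)"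
proof -
  have [measurable]: "q \<in> borel_measurable unif"
    using mono by (rule borel_measurable_unif_mono_on)
  interpret real_distribution "distr unif borel q"
    by simp
  define F where "F = cdf (distr unif borel q)"
  have cdf: "is_cdf F"
    unfolding is_cdf_def F_def
    using cdf_nondecreasing cdf_is_right_cont cdf_lim_at_bot cdf_lim_at_top_prob by (auto simp: mono_def)
  have F_eq: "F z = measure lborel {s\<in>{0<..<1}. q s \<le> z}" for z
  proof -
    have "F z = measure unif (q -` {..z} \<inter> space unif)"
      unfolding F_def cdf_def by (rule measure_distr) auto
    also have "q -` {..z} \<inter> space unif = {s\<in>{0<..<1}. q s \<le> z}" by auto
    also have "measure unif {s\<in>{0<..<1}. q s \<le> z} = measure lborel {s\<in>{0<..<1}. q s \<le> z}"
      unfolding unif_def by (rule measure_restrict_space) auto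
    finally show ?thesis .
  qed
  have sets: "{s\<in>{0<..<1}. q s \<le> z} \<in> sets lborel" for z
  proof -
    have "{s\<in>space unif. q s \<le> z} \<in> sets unif" by measurable
    then show ?thesis
      unfolding unif_def by (auto simp: sets_restrict_space_iff space_restrict_space)
  qed
  have iff: "t \<le> F z \<longleftrightarrow> q t \<le> z" if t: "t \<in> {0<..<1}" for t z
  proof
    assume "q t \<le> z"
    then have "{0<..t} \<subseteq> {s\<in>{0<..<1}. q s \<le> z}"
      using mono_onD[OF mono, of _ t] t by fastforce
    then have "measure lborel {0<..t} \<le> measure lborel {s\<in>{0<..<1}. q s \<le> z}"
      using sets
      by (intro measure_mono_fmeasurable fmeasurableI2[OF fmeasurable_cbox[of 0 1]]) (auto simp: cbox_interval)
    then show "t \<le> F z" using t by (simp add: F_eq)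
  next
    assume le: "t \<le> F z"
    show "q t \<le> z"
    proof (rule ccontr)
      assume "\<not> q t \<le> z"
      then have "\<forall>\<^sub>F s in at_left t. z < q s"
        using left[of t] t by (intro order_tendstoD) auto
      then obtain b where b: "b < t" "\<And>s. b < s \<Longrightarrow> s < t \<Longrightarrow> z < q s"
        unfolding eventually_at_left_field by auto
      define s where "s = (max b 0 + t) / 2"
      have s: "b < s" "0 < s" "s < t" using b t by (auto simp: s_def)
      then have "z < q s" using b by auto
      then have "{r\<in>{0<..<1}. q r \<le> z} \<subseteq> {0<..s}"
        using mono_onD[OF mono, of s] s t by fastforce
      then have "measure lborel {r\<in>{0<..<1}. q r \<le> z} \<le> measure lborel {0<..s}"
        using sets
        by (intro measure_mono_fmeasurable fmeasurableI2[OF fmeasurable_cbox[of 0 s]]) (auto simp: cbox_interval)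
      then show False using le s by (simp add: F_eq)
    qed
  qed
  have "quantile F t = q t" if t: "t \<in> {0<..<1}" for t
    using quantile_le_iff[OF cdf, of t] iff[OF t] t by (intro antisym) auto
  with cdf show ?thesis by blast
qed

section \<open>The riskmetric as an integral\<close>

text \<open>The integrand of the riskmetric, written with the dual distortion \<open>f\<close> (which vanishes at 0) in
  place of \<open>g\<close>.\<close>

definition tail_gap :: "(real \<Rightarrow> real) \<Rightarrow> (real \<Rightarrow> real) \<Rightarrow> real \<Rightarrow> real" where
  "tail_gap f F z = (if 0 \<le> z then f 1 - f (F z) else - f (F z))"

lemma tail_gap_measurable:
  assumes f: "continuous_on {0..1} f" and F: "is_cdf F"
  shows "tail_gap f F \<in> borel_measurable borel"
proof -
  have "F \<in> borel_measurable borel"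
    using F by (intro borel_measurable_mono) (simp add: is_cdf_def)
  then have "F \<in> measurable borel (restrict_space borel {0..1})"
    using is_cdf_bounds[OF F] by (intro measurable_restrict_space2) auto
  then have [measurable]: "(\<lambda>z. f (F z)) \<in> borel_measurable borel"
    by (rule measurable_compose[OF _ borel_measurable_continuous_on_restrict[OF f]])
  show ?thesis
    unfolding tail_gap_def[abs_def] by measurable
qed

lemma tail_gap_add: "tail_gap (\<lambda>t. a t + c * b t) F z = tail_gap a F z + c * tail_gap b F z"
  by (simp add: tail_gap_def algebra_simps)

text \<open>The values at 1 must agree because \<open>f 1\<close> enters with a positive sign for
  \<open>0 \<le> z\<close>, against the order reversal in \<open>f (F z)\<close>. For envelopes this
  is \<open>convex_env_1\<close>.\<close>

lemma tail_gap_mono: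
  assumes "is_cdf F" "\<And>t. t \<in> {0..1} \<Longrightarrow> k t \<le> f t" "k 1 = f 1"
  shows "tail_gap f F z \<le> tail_gap k F z"
  using assms(2)[of "F z"] assms(3) is_cdf_bounds[OF assms(1), of z] by (simp add: tail_gap_def)

lemma borel_measurable_unif [measurable (raw)]: "f \<in> borel_measurable borel \<Longrightarrow> f \<in> borel_measurable unif"
  unfolding unif_def by (rule measurable_restrict_space1) simp

lemma LINT_Ioo_unif:
  fixes u :: "real \<Rightarrow> real"
  assumes "u \<in> borel_measurable unif" "0 \<le> s" "s \<le> 1"
  shows "(LINT t:{0<..<s}|lborel. u t) = (LINT t|unif. indicator {..s} t * u t)"
proof -
  have "(LINT t|unif. indicator {..s} t * u t) = (LINT t|unif. indicator {..<s} t * u t)"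
  proof (rule integral_cong_AE)
    have "AE t in unif. t \<noteq> s"
      unfolding AE_unif_iff using AE_lborel_singleton[of s] by eventually_elim auto
    then show "AE t in unif. indicator {..s} t * u t = indicator {..<s} t * u t"
      by eventually_elim (auto simp: indicator_def)
  qed (use assms(1) in measurable)
  also have "\<dots> = (LINT t:{0<..<1}|lborel. indicator {..<s} t * u t)"
    by (rule integral_unif)
  also have "\<dots> = (LINT t:{0<..<s}|lborel. u t)"
    unfolding set_lebesgue_integral_def
    by (rule Bochner_Integration.integral_cong) (use assms in \<open>auto simp: indicator_def\<close>)
  finally show ?thesis ..
qed

text \<open>Fubini for the kernel \<open>K\<close>: integration over \<open>z\<close> gives
  \<open>quantile F t * u t\<close>, integration over \<open>t\<close> gives the tail gap, because
  \<open>quantile F t \<le> z\<close> amounts to \<open>t \<le> F z\<close>.\<close>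

lemma layer_cake:
  fixes u :: "real \<Rightarrow> real"
  assumes F: "is_cdf F" and u: "integrable unif u"
    and qu: "integrable unif (\<lambda>t. quantile F t * u t)"
  defines "I \<equiv> \<lambda>s. LINT t:{0<..<s}|lborel. u t"
  shows "integrable lborel (tail_gap I F)"
    and "(LINT z|lborel. tail_gap I F z) = (LINT t|unif. quantile F t * u t)"
proof -
  let ?q = "quantile F"
  have [measurable]: "u \<in> borel_measurable unif" using u by simp
  note [measurable] = quantile_measurable[OF F]
  interpret pair_sigma_finite unif lborel ..
  \<comment> \<open>\<open>u t\<close> times the signed indicator of the range between 0 and
    \<open>?q t\<close>. The signed indicator integrates to \<open>?q t\<close>, its absolute value
    to the absolute value of \<open>?q t\<close>.\<close>
  define K where "K t z = u t * ((if 0 \<le> z \<and> z < ?q t then 1 else 0) - (if z < 0 \<and> ?q t \<le> z then 1 else 0))" for t z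
  have K_ind: "K t z = u t * (indicator {0..<?q t} z - indicator {?q t..<0} z)" for t z
    by (auto simp: K_def indicator_def)
  have nK: "norm (K t z) = \<bar>u t\<bar> * (indicator {0..<?q t} z + indicator {?q t..<0} z)" for t z
    by (auto simp: K_def indicator_def)
  have ind: "integrable lborel (indicator {a..<b} :: real \<Rightarrow> real)"
      "measure lborel {a..<b} = max 0 (b - a)" for a b :: real
    by (cases "a \<le> b"; auto intro!: integrable_real_indicator)+
  have KI: "(LINT z|lborel. K t z) = ?q t * u t" for t
    unfolding K_ind by (simp add: ind max_def)
  have nKI: "(LINT z|lborel. norm (K t z)) = \<bar>?q t * u t\<bar>" for t
    unfolding nK by (simp add: ind abs_mult max_def)
  have int: "integrable (unif \<Otimes>\<^sub>M lborel) (case_prod K)"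
  proof (rule Fubini_integrable)
    show "case_prod K \<in> borel_measurable (unif \<Otimes>\<^sub>M lborel)"
      unfolding K_def by measurable
    show "integrable unif (\<lambda>t. LINT z|lborel. norm (case_prod K (t, z)))"
      unfolding case_prod_conv nKI using qu by (rule integrable_abs)
    show "AE t in unif. integrable lborel (\<lambda>z. case_prod K (t, z))"
      unfolding case_prod_conv K_ind by (intro AE_I2 integrable_mult_right Bochner_Integration.integrable_diff ind)
  qed
  have gap: "(LINT t|unif. K t z) = tail_gap I F z" for z
  proof -
    have Fz: "0 \<le> F z" "F z \<le> 1" using is_cdf_bounds[OF F] by auto
    have iff: "?q t \<le> z \<longleftrightarrow> t \<in> {..F z}" if "t \<in> space unif" for t
      using quantile_le_iff[OF F, of t z] that by auto
    have I: "I s = (LINT t|unif. indicator {..s} t * u t)" if "0 \<le> s" "s \<le> 1" for s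
      unfolding I_def using that by (intro LINT_Ioo_unif) auto
    have int_ind: "integrable unif (\<lambda>t. indicator {..s} t * u t)" for s
      by (rule Bochner_Integration.integrable_bound[OF u]) (auto simp: indicator_def)
    show ?thesis
    proof (cases "0 \<le> z")
      case True
      have "(LINT t|unif. K t z) = (LINT t|unif. indicator {..1} t * u t - indicator {..F z} t * u t)"
        by (rule Bochner_Integration.integral_cong)
           (use True iff in \<open>auto simp: K_def indicator_def not_less[symmetric]\<close>)
      also have "\<dots> = I 1 - I (F z)"
        using Fz by (simp add: I int_ind)
      finally show ?thesis using True by (simp add: tail_gap_def)
    next
      case False
      have "(LINT t|unif. K t z) = (LINT t|unif. - (indicator {..F z} t * u t))"
        by (rule Bochner_Integration.integral_cong)
           (use False iff in \<open>auto simp: K_def indicator_def\<close>)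
      also have "\<dots> = - I (F z)"
        using Fz by (simp add: I)
      finally show ?thesis using False by (simp add: tail_gap_def)
    qed
  qed
  show "integrable lborel (tail_gap I F)"
    using integrable_snd[OF int] unfolding gap .
  show "(LINT z|lborel. tail_gap I F z) = (LINT t|unif. ?q t * u t)"
    using Fubini_integral[OF int] unfolding gap KI .
qed

text \<open>The two half-lines of the riskmetric overlap only in a null set. An integrable majorant
  keeps both positive parts finite, so a failure of integrability comes from a negative part and no
  difference of infinities arises.\<close>

lemma
  fixes g :: "real \<Rightarrow> real"
  defines "f \<equiv> dual_distortion g"
  assumes F: "is_cdf F" and g: "continuous_on {0..1} g" "g 0 = 0"
  shows riskmetric_eq_integral:
      "integrable lborel (tail_gap f F) \<Longrightarrow> riskmetric g F = ereal (LINT z|lborel. tail_gap f F z)"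
    and riskmetric_eq_minus_infinity:
      "\<not> integrable lborel (tail_gap f F) \<Longrightarrow> integrable lborel k \<Longrightarrow> (\<And>z. tail_gap f F z \<le> k z) \<Longrightarrow>
        riskmetric g F = - \<infinity>"
proof -
  let ?\<psi> = "tail_gap f F"
  have "continuous_on {0..1} f"
    unfolding f_def dual_distortion_def[abs_def]
    by (intro continuous_intros continuous_on_compose2[OF g(1)]) auto
  from tail_gap_measurable[OF this F] have [measurable]: "?\<psi> \<in> borel_measurable borel" .
  define p1 n1 p2 n2 where
    "p1 = (\<integral>\<^sup>+z. ennreal (?\<psi> z) * indicator {0..} z \<partial>lborel)" and
    "n1 = (\<integral>\<^sup>+z. ennreal (- ?\<psi> z) * indicator {0..} z \<partial>lborel)" and
    "p2 = (\<integral>\<^sup>+z. ennreal (?\<psi> z) * indicator {..<0} z \<partial>lborel)" and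
    "n2 = (\<integral>\<^sup>+z. ennreal (- ?\<psi> z) * indicator {..<0} z \<partial>lborel)"
  have split: "(\<integral>\<^sup>+z. ennreal (h z) \<partial>lborel) =
      (\<integral>\<^sup>+z. ennreal (h z) * indicator {0..} z \<partial>lborel) + (\<integral>\<^sup>+z. ennreal (h z) * indicator {..<0} z \<partial>lborel)"
    if [measurable]: "h \<in> borel_measurable borel" for h :: "real \<Rightarrow> real"
  proof -
    have "(\<integral>\<^sup>+z. ennreal (h z) \<partial>lborel) =
        (\<integral>\<^sup>+z. ennreal (h z) * indicator {0..} z + ennreal (h z) * indicator {..<0} z \<partial>lborel)"
      by (rule nn_integral_cong) (auto simp: indicator_def)
    then show ?thesis by (simp add: nn_integral_add)
  qed
  have P: "(\<integral>\<^sup>+z. ennreal (?\<psi> z) \<partial>lborel) = p1 + p2"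
    unfolding p1_def p2_def by (rule split) simp
  have N: "(\<integral>\<^sup>+z. ennreal (- ?\<psi> z) \<partial>lborel) = n1 + n2"
    unfolding n1_def n2_def by (rule split) simp
  have ae: "AE z in lborel. z \<noteq> (0::real)"
    by (rule AE_lborel_singleton)
  have pos: "?\<psi> z = g (1 - F z)" if "0 \<le> z" for z
    using that g(2) by (simp add: tail_gap_def f_def dual_distortion_def)
  have neg: "?\<psi> z = g (1 - F z) - g 1" if "z < 0" for z
    using that by (simp add: tail_gap_def f_def dual_distortion_def)
  have "ext_integral {0..} (\<lambda>z. g (1 - F z)) = enn2ereal p1 - enn2ereal n1"
    unfolding ext_integral_def p1_def n1_def
    by (intro arg_cong2[where f = minus] arg_cong[where f = enn2ereal] nn_integral_cong)
       (auto simp: indicator_def pos)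
  moreover have "ext_integral {..0} (\<lambda>z. g (1 - F z) - g 1) = enn2ereal p2 - enn2ereal n2"
    unfolding ext_integral_def p2_def n2_def
  proof (intro arg_cong2[where f = minus] arg_cong[where f = enn2ereal] nn_integral_cong_AE)
    show "AE z in lborel. ennreal (g (1 - F z) - g 1) * indicator {..0} z = ennreal (?\<psi> z) * indicator {..<0} z"
      using ae by eventually_elim (auto simp: indicator_def neg)
    show "AE z in lborel. ennreal (- (g (1 - F z) - g 1)) * indicator {..0} z = ennreal (- ?\<psi> z) * indicator {..<0} z"
      using ae by eventually_elim (auto simp: indicator_def neg)
  qed
  ultimately have R: "riskmetric g F = (enn2ereal p1 - enn2ereal n1) + (enn2ereal p2 - enn2ereal n2)"
    by (simp add: riskmetric_def)
  have fin: "enn2ereal a = ereal (enn2real a)" if "a \<noteq> \<top>" for a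
    using that by (cases a) auto
  show "riskmetric g F = ereal (LINT z|lborel. ?\<psi> z)" if int: "integrable lborel ?\<psi>"
  proof -
    have *: "p1 + p2 \<noteq> \<top>" "n1 + n2 \<noteq> \<top>"
      using int P N by (auto simp: real_integrable_def)
    then have ne: "p1 \<noteq> \<top>" "p2 \<noteq> \<top>" "n1 \<noteq> \<top>" "n2 \<noteq> \<top>"
      by auto
    have "(LINT z|lborel. ?\<psi> z) = enn2real (p1 + p2) - enn2real (n1 + n2)"
      using real_lebesgue_integral_def[OF int] by (simp add: P N)
    also have "\<dots> = (enn2real p1 + enn2real p2) - (enn2real n1 + enn2real n2)"
      using ne by (simp add: enn2real_plus top.not_eq_extremum)
    finally show ?thesis
      unfolding R by (simp add: fin ne)
  qed
  show "riskmetric g F = - \<infinity>" if ni: "\<not> integrable lborel ?\<psi>" and k: "integrable lborel k" "\<And>z. ?\<psi> z \<le> k z"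
  proof -
    have "(\<integral>\<^sup>+z. ennreal (?\<psi> z) \<partial>lborel) \<le> (\<integral>\<^sup>+z. ennreal (k z) \<partial>lborel)"
      by (intro nn_integral_mono ennreal_leI k)
    also have "\<dots> < \<top>"
      using k(1) by (auto simp: real_integrable_def top.not_eq_extremum)
    finally have P': "p1 + p2 < \<top>" by (simp add: P)
    then have ne: "p1 \<noteq> \<top>" "p2 \<noteq> \<top>" by auto
    have "n1 + n2 = \<top>"
      using ni P' by (auto simp: real_integrable_def P N)
    then have "n1 = \<top> \<or> n2 = \<top>" by simp
    then show ?thesis
      unfolding R using ne by (cases "n1 = \<top>"; cases "n2 = \<top>") (auto simp: fin)
  qed
qed

section \<open>Square-integrable functions\<close>

definition sq_integrable :: "(real \<Rightarrow> real) \<Rightarrow> bool" where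
  "sq_integrable f \<longleftrightarrow> f \<in> borel_measurable unif \<and> integrable unif (\<lambda>t. (f t)\<^sup>2)"

definition inn :: "(real \<Rightarrow> real) \<Rightarrow> (real \<Rightarrow> real) \<Rightarrow> real" where
  "inn f g = (LINT t|unif. f t * g t)"

lemma sq_integrable_mult:
  assumes "sq_integrable f" "sq_integrable g"
  shows "integrable unif (\<lambda>t. f t * g t)"
proof (rule Bochner_Integration.integrable_bound)
  show "integrable unif (\<lambda>t. (f t)\<^sup>2 + (g t)\<^sup>2)"
    using assms by (auto simp: sq_integrable_def)
  show "(\<lambda>t. f t * g t) \<in> borel_measurable unif"
    using assms by (auto simp: sq_integrable_def)
  have "\<bar>a * b\<bar> \<le> \<bar>a\<^sup>2 + b\<^sup>2\<bar>" for a b :: real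
  proof -
    have "0 \<le> (\<bar>a\<bar> - \<bar>b\<bar>)\<^sup>2" by simp
    then have "2 * \<bar>a * b\<bar> \<le> a\<^sup>2 + b\<^sup>2"
      by (simp add: power2_diff abs_mult)
    then show ?thesis by simp
  qed
  then show "AE t in unif. norm (f t * g t) \<le> norm ((f t)\<^sup>2 + (g t)\<^sup>2)"
    by simp
qed

lemma sq_integrable_const [simp]: "sq_integrable (\<lambda>_. c)"
  by (simp add: sq_integrable_def)

lemma sq_integrable_cmult: "sq_integrable f \<Longrightarrow> sq_integrable (\<lambda>t. c * f t)"
  by (auto simp: sq_integrable_def power_mult_distrib)

lemma sq_integrable_add:
  assumes "sq_integrable f" "sq_integrable g"
  shows "sq_integrable (\<lambda>t. f t + g t)"
proof -
  have "integrable unif (\<lambda>t. (f t)\<^sup>2 + 2 * (f t * g t) + (g t)\<^sup>2)"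
    using assms sq_integrable_mult[OF assms] by (auto simp: sq_integrable_def)
  moreover have "(f t)\<^sup>2 + 2 * (f t * g t) + (g t)\<^sup>2 = (f t + g t)\<^sup>2" for t
    by (simp add: power2_sum)
  ultimately show ?thesis using assms by (auto simp: sq_integrable_def)
qed

lemma sq_integrable_diff:
  assumes "sq_integrable f" "sq_integrable g"
  shows "sq_integrable (\<lambda>t. f t - g t)"
  using sq_integrable_add[OF assms(1) sq_integrable_cmult[OF assms(2), of "-1"]] by simp

lemma sq_integrable_integrable:
  assumes "sq_integrable f"
  shows "integrable unif f"
  using sq_integrable_mult[OF assms sq_integrable_const[of 1]] by simp

lemma sq_integrable_cong:
  assumes "\<And>t. t \<in> {0<..<1} \<Longrightarrow> f t = g t"
  shows "sq_integrable f \<longleftrightarrow> sq_integrable g"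
proof -
  have "f \<in> borel_measurable unif \<longleftrightarrow> g \<in> borel_measurable unif"
    by (rule measurable_cong) (use assms in simp)
  moreover have "integrable unif (\<lambda>t. (f t)\<^sup>2) \<longleftrightarrow> integrable unif (\<lambda>t. (g t)\<^sup>2)"
    by (rule Bochner_Integration.integrable_cong) (use assms in simp_all)
  ultimately show ?thesis by (simp add: sq_integrable_def)
qed

lemma inn_cong:
  assumes "\<And>t. t \<in> {0<..<1} \<Longrightarrow> f t = f' t" "\<And>t. t \<in> {0<..<1} \<Longrightarrow> g t = g' t"
  shows "inn f g = inn f' g'"
  unfolding inn_def by (rule Bochner_Integration.integral_cong) (use assms in simp_all)

lemma inn_commute: "inn f g = inn g f"
  by (simp add: inn_def mult.commute)

lemma inn_add_left:
  "sq_integrable f \<Longrightarrow> sq_integrable g \<Longrightarrow> sq_integrable k \<Longrightarrow> inn (\<lambda>t. f t + g t) k = inn f k + inn g k"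
  by (simp add: inn_def distrib_right sq_integrable_mult)

lemma inn_diff_left:
  "sq_integrable f \<Longrightarrow> sq_integrable g \<Longrightarrow> sq_integrable k \<Longrightarrow> inn (\<lambda>t. f t - g t) k = inn f k - inn g k"
  by (simp add: inn_def left_diff_distrib sq_integrable_mult)

lemma inn_cmult_left: "inn (\<lambda>t. c * f t) g = c * inn f g"
  by (simp add: inn_def mult.assoc)

lemma inn_const: "inn (\<lambda>_. c) f = c * (LINT t|unif. f t)"
  by (simp add: inn_def)

lemma inn_self_nonneg: "0 \<le> inn f f"
  by (simp add: inn_def)

lemmas inn_left = inn_add_left inn_diff_left inn_cmult_left

lemma inn_add_right:
  "sq_integrable f \<Longrightarrow> sq_integrable g \<Longrightarrow> sq_integrable k \<Longrightarrow> inn k (\<lambda>t. f t + g t) = inn k f + inn k g"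
  by (simp add: inn_commute[of k] inn_add_left)

lemma inn_diff_right:
  "sq_integrable f \<Longrightarrow> sq_integrable g \<Longrightarrow> sq_integrable k \<Longrightarrow> inn k (\<lambda>t. f t - g t) = inn k f - inn k g"
  by (simp add: inn_commute[of k] inn_diff_left)

lemma inn_cmult_right: "inn g (\<lambda>t. c * f t) = c * inn g f"
  by (simp add: inn_commute[of g] inn_cmult_left)

lemmas inn_right = inn_add_right inn_diff_right inn_cmult_right
lemmas sq_integrable_intros = sq_integrable_add sq_integrable_diff sq_integrable_cmult sq_integrable_const

lemma sq_dist_expand:
  assumes "sq_integrable f" "sq_integrable g"
  shows "inn (\<lambda>t. f t - g t) (\<lambda>t. f t - g t) = inn f f - 2 * inn f g + inn g g"
  using assms by (simp add: inn_left inn_right sq_integrable_diff inn_commute[of g f])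

lemma sq_sum_expand:
  assumes "sq_integrable f" "sq_integrable g"
  shows "inn (\<lambda>t. f t + g t) (\<lambda>t. f t + g t) = inn f f + 2 * inn f g + inn g g"
  using assms by (simp add: inn_left inn_right sq_integrable_add inn_commute[of g f])

section \<open>Square integrability of the derivative of a convex function\<close>

lemma tail_gap_cong:
  assumes "is_cdf F" "\<And>t. t \<in> {0..1} \<Longrightarrow> f t = k t"
  shows "tail_gap f F = tail_gap k F"
  using assms is_cdf_bounds[OF assms(1)] by (auto simp: tail_gap_def fun_eq_iff)

lemma convex_layer_cake:
  assumes F: "is_cdf F" and H: "convex_on {0..1} H" "continuous_on {0..1} H" "H 0 = 0"
    and int: "integrable unif (\<lambda>t. quantile F t * left_deriv H t)"
  shows "integrable lborel (tail_gap H F)"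
    and "(LINT z|lborel. tail_gap H F z) = (LINT t|unif. quantile F t * left_deriv H t)"
proof -
  have "integrable unif (left_deriv H)"
    unfolding integrable_unif_iff by (rule convex_left_deriv_integrable[OF H(1,2)])
  note lc = layer_cake[OF F this int]
  have "tail_gap (\<lambda>s. LINT t:{0<..<s}|lborel. left_deriv H t) F = tail_gap H F"
    by (rule tail_gap_cong[OF F]) (use convex_left_deriv_integral[OF H(1,2)] H(3) in auto)
  with lc show "integrable lborel (tail_gap H F)"
      "(LINT z|lborel. tail_gap H F z) = (LINT t|unif. quantile F t * left_deriv H t)"
    by simp_all
qed

text \<open>The hypotheses say that the derivative of \<open>H\<close> is majorized by \<open>v\<close>; testing against the
  truncations of that derivative bounds its norm by that of \<open>v\<close>.\<close>

lemma sq_integrable_left_deriv_majorized: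
  assumes H: "convex_on {0..1} H" "continuous_on {0..1} H" "H 0 = 0"
    and v: "sq_integrable v"
    and le: "\<And>s. s \<in> {0..1} \<Longrightarrow> (LINT t:{0<..<s}|lborel. v t) \<le> H s"
    and eq: "(LINT t:{0<..<1}|lborel. v t) = H 1"
  shows "sq_integrable (left_deriv H)"
proof -
  let ?d = "left_deriv H"
  note mono = convex_left_deriv_mono[OF H(1)]
  have d: "integrable unif ?d"
    unfolding integrable_unif_iff by (rule convex_left_deriv_integrable[OF H(1,2)])
  then have [measurable]: "?d \<in> borel_measurable unif" by simp
  define w where "w n t = max (- real n) (min (real n) (?d t))" for n :: nat and t
  have [measurable]: "w n \<in> borel_measurable unif" for n
    unfolding w_def[abs_def] by measurable
  have w_bd: "\<bar>w n t\<bar> \<le> real n" for n t by (auto simp: w_def)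
  have w_le: "(w n t)\<^sup>2 \<le> w n t * ?d t" for n t
  proof -
    have "(max (- c) (min c x))\<^sup>2 \<le> max (- c) (min c x) * x" if "0 \<le> c" for c x :: real
      using that mult_left_mono[of c "- x" c] mult_left_mono[of c x c]
      by (cases "x < - c"; cases "c < x") (auto simp: power2_eq_square max_def min_def)
    then show ?thesis by (simp add: w_def)
  qed
  have wd: "integrable unif (\<lambda>t. w n t * ?d t)" for n
  proof (rule Bochner_Integration.integrable_bound)
    show "integrable unif (\<lambda>t. real n * ?d t)" using d by simp
    show "AE t in unif. norm (w n t * ?d t) \<le> norm (real n * ?d t)"
      using w_bd by (auto simp: abs_mult intro!: mult_right_mono)
  qed measurable
  have w_sq: "sq_integrable (w n)" for n
    unfolding sq_integrable_def
  proof
    show "integrable unif (\<lambda>t. (w n t)\<^sup>2)"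
      by (rule Bochner_Integration.integrable_bound[OF wd[of n]])
         (auto intro!: AE_I2 order_trans[OF w_le abs_ge_self])
  qed measurable
  have bound: "(LINT t|unif. (w n t)\<^sup>2) \<le> inn v v" for n
  proof -
    \<comment> \<open>Truncation preserves monotonicity and left continuity, so \<open>w n\<close>
      is the quantile function of a CDF and the layer-cake formulas apply to it.\<close>
    have "mono_on {0<..<1} (w n)"
      unfolding w_def by (intro mono_onI max.mono min.mono order_refl mono_onD[OF mono])
    moreover have "(w n \<longlongrightarrow> w n t) (at_left t)" if "0 < t" "t < 1" for t
      unfolding w_def[abs_def] by (intro tendsto_intros convex_left_deriv_left_cont[OF H(1) that])
    ultimately obtain F where F: "is_cdf F" "\<And>t. t \<in> {0<..<1} \<Longrightarrow> quantile F t = w n t"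
      using ex_cdf_with_quantile by blast
    have cong: "integrable unif (\<lambda>t. quantile F t * f t) \<longleftrightarrow> integrable unif (\<lambda>t. w n t * f t)"
      "(LINT t|unif. quantile F t * f t) = (LINT t|unif. w n t * f t)" for f
      by (rule Bochner_Integration.integrable_cong Bochner_Integration.integral_cong; use F(2) in simp)+
    note lH = convex_layer_cake[OF F(1) H, unfolded cong, OF wd]
    note lv = layer_cake[OF F(1) sq_integrable_integrable[OF v], unfolded cong, OF sq_integrable_mult[OF w_sq v]]
    have "(LINT z|lborel. tail_gap H F z) \<le> (LINT z|lborel. tail_gap (\<lambda>s. LINT t:{0<..<s}|lborel. v t) F z)"
      by (intro integral_mono lH lv tail_gap_mono[OF F(1)] le eq)
    then have "(LINT t|unif. w n t * ?d t) \<le> inn (w n) v"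
      unfolding lH lv inn_def .
    moreover have "(LINT t|unif. (w n t)\<^sup>2) \<le> (LINT t|unif. w n t * ?d t)"
      by (intro integral_mono w_le wd) (use w_sq in \<open>simp add: sq_integrable_def\<close>)
    \<comment> \<open>Combined with the two preceding bounds, which give
      \<open>inn (w n) (w n) \<le> inn (w n) v\<close>, this yields
      \<open>inn (w n) (w n) \<le> inn v v\<close>.\<close>
    moreover have "0 \<le> inn (w n) (w n) - 2 * inn (w n) v + inn v v"
      using inn_self_nonneg sq_dist_expand[OF w_sq v] by metis
    ultimately show ?thesis
      by (simp add: inn_def power2_eq_square)
  qed
  \<comment> \<open>Fatou's lemma: at each point the truncations eventually coincide with
    \<open>?d\<close>, and the bound by \<open>inn v v\<close> is uniform in
    \<open>n\<close>.\<close>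
  have "(\<integral>\<^sup>+t. ennreal ((?d t)\<^sup>2) \<partial>unif) = (\<integral>\<^sup>+t. liminf (\<lambda>n. ennreal ((w n t)\<^sup>2)) \<partial>unif)"
  proof (rule nn_integral_cong)
    fix t
    have "\<forall>\<^sub>F n in sequentially. w n t = ?d t"
    proof (rule eventually_sequentiallyI)
      show "w n t = ?d t" if "nat \<lceil>\<bar>?d t\<bar>\<rceil> \<le> n" for n
        using that unfolding w_def by linarith
    qed
    then have "(\<lambda>n. ennreal ((w n t)\<^sup>2)) \<longlonglongrightarrow> ennreal ((?d t)\<^sup>2)"
      by (intro tendsto_eventually) (auto elim: eventually_mono)
    then show "ennreal ((?d t)\<^sup>2) = liminf (\<lambda>n. ennreal ((w n t)\<^sup>2))"
      by (rule lim_imp_Liminf[OF trivial_limit_sequentially, symmetric])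
  qed
  also have "\<dots> \<le> liminf (\<lambda>n. \<integral>\<^sup>+t. ennreal ((w n t)\<^sup>2) \<partial>unif)"
    by (rule nn_integral_liminf) measurable
  also have "\<dots> \<le> liminf (\<lambda>n. ennreal (inn v v))"
  proof (rule Liminf_mono, rule always_eventually, rule allI)
    fix n
    have "(\<integral>\<^sup>+t. ennreal ((w n t)\<^sup>2) \<partial>unif) = ennreal (LINT t|unif. (w n t)\<^sup>2)"
      using w_sq[of n] by (intro nn_integral_eq_integral) (auto simp: sq_integrable_def)
    then show "(\<integral>\<^sup>+t. ennreal ((w n t)\<^sup>2) \<partial>unif) \<le> ennreal (inn v v)"
      using bound[of n] by (simp add: ennreal_leI)
  qed
  also have "\<dots> < \<infinity>" by (simp add: Liminf_const)
  finally have "integrable unif (\<lambda>t. (?d t)\<^sup>2)"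
    by (intro integrableI_bounded) auto
  then show ?thesis by (simp add: sq_integrable_def)
qed

lemma LINT_Ioo_mono_increment:
  fixes f :: "real \<Rightarrow> real"
  assumes f: "set_integrable lborel {a<..<b} f" and mono: "mono_on {a<..<b} f"
    and xy: "a \<le> x" "x \<le> w" "w \<le> y" "y \<le> b" and w: "a < w" "w < b"
  shows "(LINT t:{a<..<w}|lborel. f t) - (LINT t:{a<..<x}|lborel. f t) \<le> f w * (w - x)"
    and "f w * (y - w) \<le> (LINT t:{a<..<y}|lborel. f t) - (LINT t:{a<..<w}|lborel. f t)"
proof -
  have I: "f integrable_on {a..s}" "(LINT t:{a<..<s}|lborel. f t) = integral {a..s} f"
    if "a \<le> s" "s \<le> b" for s
    using LINT_Ioo_eq_integral[OF f that] by auto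
  have diff: "(LINT t:{a<..<s}|lborel. f t) - (LINT t:{a<..<r}|lborel. f t) = integral {r..s} f"
    "f integrable_on {r..s}" if "a \<le> r" "r \<le> s" "s \<le> b" for r s
  proof -
    show "f integrable_on {r..s}"
      by (rule integrable_on_subinterval[OF I(1)[of s]]) (use that in auto)
    show "(LINT t:{a<..<s}|lborel. f t) - (LINT t:{a<..<r}|lborel. f t) = integral {r..s} f"
      using Henstock_Kurzweil_Integration.integral_combine[OF that(1,2) I(1)[of s]] I(2)[of r] I(2)[of s] that
      by simp
  qed
  have "integral {x..w} f \<le> integral {x..w} (\<lambda>_. f w)"
  proof -
    have "integral {x<..<w} f \<le> integral {x<..<w} (\<lambda>_. f w)"
      using mono_onD[OF mono, of _ w] xy w diff(2)[of x w]
      by (intro integral_le) (auto simp: integrable_on_Icc_iff_Ioo[symmetric])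
    then show ?thesis by (simp only: integral_open_interval_real)
  qed
  then show "(LINT t:{a<..<w}|lborel. f t) - (LINT t:{a<..<x}|lborel. f t) \<le> f w * (w - x)"
    using diff(1)[of x w] xy w by (simp add: mult.commute)
  have "integral {w..y} (\<lambda>_. f w) \<le> integral {w..y} f"
  proof -
    have "integral {w<..<y} (\<lambda>_. f w) \<le> integral {w<..<y} f"
      using mono_onD[OF mono, of w] xy w diff(2)[of w y]
      by (intro integral_le) (auto simp: integrable_on_Icc_iff_Ioo[symmetric])
    then show ?thesis by (simp only: integral_open_interval_real)
  qed
  then show "f w * (y - w) \<le> (LINT t:{a<..<y}|lborel. f t) - (LINT t:{a<..<w}|lborel. f t)"
    using diff(1)[of w y] xy w by (simp add: mult.commute)
qed

lemma convex_on_LINT_Ioo: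
  fixes f :: "real \<Rightarrow> real"
  assumes f: "set_integrable lborel {a<..<b} f" and mono: "mono_on {a<..<b} f"
  shows "convex_on {a..b} (\<lambda>s. LINT t:{a<..<s}|lborel. f t)"
proof (rule convex_on_linorderI)
  let ?P = "\<lambda>s. LINT t:{a<..<s}|lborel. f t"
  fix t x y :: real assume t: "0 < t" "t < 1" and xy: "x \<in> {a..b}" "y \<in> {a..b}" "x < y"
  define w where "w = (1 - t) *\<^sub>R x + t *\<^sub>R y"
  have wx: "w - x = t * (y - x)" and yw: "y - w = (1 - t) * (y - x)"
    by (auto simp: w_def algebra_simps)
  have "0 < t * (y - x)" "0 < (1 - t) * (y - x)" using t xy by auto
  then have lt: "x < w" "w < y" unfolding wx[symmetric] yw[symmetric] by simp_all
  have "?P w - ?P x \<le> f w * (w - x)" "f w * (y - w) \<le> ?P y - ?P w"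
    using lt xy by (intro LINT_Ioo_mono_increment[OF f mono]; auto)+
  then have "(1 - t) * (?P w - ?P x) \<le> (1 - t) * (f w * (w - x))" "t * (f w * (y - w)) \<le> t * (?P y - ?P w)"
    using t by (auto intro!: mult_left_mono)
  moreover have "(1 - t) * (f w * (w - x)) = t * (f w * (y - w))"
    unfolding wx yw by (simp add: algebra_simps)
  ultimately have "?P w \<le> (1 - t) * ?P x + t * ?P y"
    by (simp add: algebra_simps)
  then show "?P ((1 - t) *\<^sub>R x + t *\<^sub>R y) \<le> (1 - t) * ?P x + t * ?P y"
    by (simp add: w_def)
qed simp

section \<open>The Lagrangian\<close>

lemma inn_self_eq_0:
  assumes "sq_integrable f" "inn f f = 0"
  shows "AE t in unif. f t = 0"
proof -
  have "integrable unif (\<lambda>t. f t * f t)" using sq_integrable_mult[OF assms(1) assms(1)] .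
  then have "AE t in unif. f t * f t = 0"
    using integral_nonneg_eq_0_iff_AE[of unif "\<lambda>t. f t * f t"] assms(2) by (simp add: inn_def)
  then show ?thesis by simp
qed

lemma AE_lborel_interval_point:
  fixes a b :: real
  assumes "AE x in lborel. P x" "a < b"
  shows "\<exists>x\<in>{a<..<b}. P x"
proof (rule ccontr)
  assume "\<not> (\<exists>x\<in>{a<..<b}. P x)"
  with assms(1) have "AE x in lborel. x \<notin> {a<..<b}"
    by (auto elim!: eventually_mono)
  then have "{a<..<b} \<in> null_sets lborel"
    by (subst AE_iff_null_sets) auto
  then show False using assms(2) by (simp add: null_sets_def)
qed

text \<open>A difference at \<open>t\<close> would persist on an interval left of \<open>t\<close>,
  which is not a null set. This turns vanishing mean-square distance into equality of quantile
  functions at every level.\<close>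

lemma AE_unif_eq_left_cont:
  fixes f g :: "real \<Rightarrow> real"
  assumes ae: "AE t in unif. f t = g t"
    and f: "\<And>t. 0 < t \<Longrightarrow> t < 1 \<Longrightarrow> (f \<longlongrightarrow> f t) (at_left t)"
    and g: "\<And>t. 0 < t \<Longrightarrow> t < 1 \<Longrightarrow> (g \<longlongrightarrow> g t) (at_left t)"
    and t: "0 < t" "t < 1"
  shows "f t = g t"
proof (rule ccontr)
  assume "f t \<noteq> g t"
  then have "\<forall>\<^sub>F s in at_left t. f s - g s \<noteq> 0"
    by (intro tendsto_imp_eventually_ne[where c = "f t - g t"] tendsto_diff f g t) simp_all
  then obtain b where b: "b < t" "\<And>s. b < s \<Longrightarrow> s < t \<Longrightarrow> f s \<noteq> g s"
    unfolding eventually_at_left_field by auto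
  have "\<exists>s\<in>{max b 0<..<t}. s \<in> {0<..<1} \<longrightarrow> f s = g s"
    using ae b(1) t unfolding AE_unif_iff by (intro AE_lborel_interval_point) auto
  then show False using b(2) t by auto
qed

lemma dual_distortion_props:
  assumes "g \<in> distortions"
  shows "continuous_on {0..1} (dual_distortion g)" "dual_distortion g 0 = 0" "dual_distortion g 1 = g 1"
proof -
  have "continuous_on {0..1} g" "g 0 = 0" using assms by (auto simp: distortions_def)
  then show "continuous_on {0..1} (dual_distortion g)" "dual_distortion g 0 = 0" "dual_distortion g 1 = g 1"
    unfolding dual_distortion_def[abs_def]
    by (auto intro!: continuous_intros elim: continuous_on_compose2)
qed

locale worst_case =
  fixes G g :: "real \<Rightarrow> real" and \<epsilon> \<gamma> :: real
  assumes cdf_G: "is_cdf G" and second_moment_G: "finite_second_moment G"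
    and eps_pos: "0 < \<epsilon>" and gamma_pos: "0 < \<gamma>"
    and g: "g \<in> distortions"
    and env_deriv: "set_integrable lborel {0<..<1} (\<lambda>t. (left_deriv (convex_env (dual_distortion g)) t)\<^sup>2)"
    and not_constant: "\<And>l. 0 \<le> l \<Longrightarrow> \<not> left_deriv (convex_env (h_fun g G \<gamma> l)) constant_on {0<..<1}"
begin

abbreviation "p \<equiv> quantile G"
abbreviation "gd \<equiv> dual_distortion g"
abbreviation "h \<equiv> h_fun g G \<gamma>"
abbreviation "e l \<equiv> convex_env (h l)"
abbreviation "u l \<equiv> left_deriv (e l)"
abbreviation "\<mu> \<equiv> cdf_mean G"

definition P :: "real \<Rightarrow> real" where
  "P t = (LINT s:{0<..<t}|lborel. p s)"

lemmas gd = dual_distortion_props[OF g]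

lemma p_sq: "sq_integrable p"
  using cdf_G second_moment_G by (simp add: sq_integrable_def finite_second_moment_iff quantile_measurable)

lemma p_int: "set_integrable lborel {0<..<1} p"
  using sq_integrable_integrable[OF p_sq] by (simp add: integrable_unif_iff)

lemma mu_eq: "\<mu> = (LINT t|unif. p t)"
  by (rule cdf_mean_eq[OF cdf_G])

lemma P_props: "continuous_on {0..1} P" "convex_on {0..1} P" "P 0 = 0" "P 1 = \<mu>"
proof -
  show "continuous_on {0..1} P"
    unfolding P_def by (rule continuous_on_LINT_Ioo[OF p_int])
  show "convex_on {0..1} P"
    unfolding P_def by (rule convex_on_LINT_Ioo[OF p_int quantile_mono[OF cdf_G]])
  show "P 0 = 0" by (simp add: P_def set_lebesgue_integral_def)
  show "P 1 = \<mu>" by (simp add: P_def mu_eq integral_unif)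
qed

lemma h_eq: "h l t = gd t + 2 * (\<gamma> + l) * P t"
  by (simp add: h_fun_def P_def)

lemma h_props: "continuous_on {0..1} (h l)" "h l 0 = 0" "h l 1 = g 1 + 2 * (\<gamma> + l) * \<mu>"
  unfolding h_eq by (intro continuous_intros gd P_props) (simp_all add: gd P_props)

lemmas e_props = convex_env_convex[OF h_props(1,2)] convex_env_continuous[OF h_props(1,2)]
  convex_env_0[OF h_props(1,2)]

lemma e_1: "e l 1 = h l 1"
  by (rule convex_env_1[OF h_props(1,2)])

lemma u_mono: "mono_on {0<..<1} (u l)"
  by (rule convex_left_deriv_mono[OF e_props(1)])

lemma u_left_cont: "0 < t \<Longrightarrow> t < 1 \<Longrightarrow> (u l \<longlongrightarrow> u l t) (at_left t)"
  by (rule convex_left_deriv_left_cont[OF e_props(1)])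

lemma LINT_u: "0 \<le> s \<Longrightarrow> s \<le> 1 \<Longrightarrow> (LINT t:{0<..<s}|lborel. u l t) = e l s"
  using convex_left_deriv_integral[OF e_props(1,2)] e_props(3) by simp

lemma u_mean: "(LINT t|unif. u l t) = h l 1"
  by (simp add: integral_unif LINT_u e_1)

text \<open>The majorant of \<open>u l\<close> is the derivative of \<open>convex_env gd + 2 (\<gamma> + l) P\<close>, a convex minorant of
  \<open>h l\<close>.\<close>

lemma u_sq:
  assumes l: "0 \<le> l"
  shows "sq_integrable (u l)"
proof -
  let ?c = "2 * (\<gamma> + l)" and ?k = "convex_env gd"
  note k = convex_env_convex[OF gd(1,2)] convex_env_continuous[OF gd(1,2)] convex_env_0[OF gd(1,2)]
  define v where "v t = left_deriv ?k t + ?c * p t" for t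
  have c: "0 \<le> ?c" using l gamma_pos by simp
  have dk: "set_integrable lborel {0<..<1} (left_deriv ?k)"
    by (rule convex_left_deriv_integrable[OF k(1,2)])
  have dk_sq: "sq_integrable (left_deriv ?k)"
    using env_deriv borel_measurable_unif_mono_on[OF convex_left_deriv_mono[OF k(1)]]
    by (simp add: sq_integrable_def integrable_unif_iff)
  have LINT_v: "(LINT t:{0<..<s}|lborel. v t) = ?k s + ?c * P s" if s: "0 \<le> s" "s \<le> 1" for s
  proof -
    have "set_integrable lborel {0<..<s} (left_deriv ?k)" "set_integrable lborel {0<..<s} (\<lambda>t. ?c * p t)"
      using s by (auto intro!: set_integrable_mult_right intro: set_integrable_subset[OF dk] set_integrable_subset[OF p_int])
    then show ?thesis
      unfolding v_def by (subst set_integral_add(2)) (use s in \<open>simp_all add: P_def convex_left_deriv_integral[OF k(1,2)] k(3)\<close>)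
  qed
  have minorant: "(\<lambda>s. ?k s + ?c * P s) \<in> convex_minorants (h l)"
    unfolding convex_minorants_def mem_Collect_eq
  proof (intro conjI ballI distortionsI_convex)
    show conv: "convex_on {0..1} (\<lambda>s. ?k s + ?c * P s)"
      using c by (intro convex_on_add convex_on_cmul k P_props)
    then show "convex_on {0..1} (\<lambda>s. ?k s + ?c * P s)" .
    show "continuous_on {0..1} (\<lambda>s. ?k s + ?c * P s)"
      by (intro continuous_intros k P_props)
    show "?k 0 + ?c * P 0 = 0" by (simp add: k P_props)
    show "?k s + ?c * P s \<le> h l s" if "s \<in> {0..1}" for s
      using convex_env_le[OF gd(1,2) that] by (simp add: h_eq)
  qed
  show ?thesis
  proof (rule sq_integrable_left_deriv_majorized[OF e_props])
    show "sq_integrable v"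
      unfolding v_def by (intro sq_integrable_intros dk_sq p_sq)
    show "(LINT t:{0<..<s}|lborel. v t) \<le> e l s" if "s \<in> {0..1}" for s
      using LINT_v[of s] convex_env_greatest[OF h_props(1,2) minorant that] that by simp
    show "(LINT t:{0<..<1}|lborel. v t) = e l 1"
      using LINT_v[of 1] convex_env_1[OF gd(1,2)] by (simp add: e_1 h_eq)
  qed
qed

section \<open>The riskmetric and the envelope of \<open>h l\<close>\<close>

definition risk :: "(real \<Rightarrow> real) \<Rightarrow> real" where
  "risk F = (LINT z|lborel. tail_gap gd F z)"

text \<open>Without the last condition \<open>risk\<close> would return the default value 0 of the
  Bochner integral where the riskmetric is minus infinity.\<close>

definition finite_risk :: "(real \<Rightarrow> real) \<Rightarrow> bool" where
  "finite_risk F \<longleftrightarrow> is_cdf F \<and> sq_integrable (quantile F) \<and> integrable lborel (tail_gap gd F)"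

lemma tail_gap_h: "tail_gap (h l) F z = tail_gap gd F z + 2 * (\<gamma> + l) * tail_gap P F z"
  unfolding tail_gap_add[symmetric] by (simp add: tail_gap_def h_eq)

lemma
  assumes F: "is_cdf F" "sq_integrable (quantile F)"
  shows tail_gap_P: "integrable lborel (tail_gap P F)" "(LINT z|lborel. tail_gap P F z) = inn (quantile F) p"
    and tail_gap_e: "0 \<le> l \<Longrightarrow> integrable lborel (tail_gap (e l) F)"
      "0 \<le> l \<Longrightarrow> (LINT z|lborel. tail_gap (e l) F z) = inn (quantile F) (u l)"
    and tail_gap_h_le: "tail_gap (h l) F z \<le> tail_gap (e l) F z"
proof -
  have P: "(\<lambda>s. LINT t:{0<..<s}|lborel. p t) = P" by (simp add: P_def fun_eq_iff)
  note lc = layer_cake[OF F(1) sq_integrable_integrable[OF p_sq] sq_integrable_mult[OF F(2) p_sq], unfolded P]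
  show "integrable lborel (tail_gap P F)" "(LINT z|lborel. tail_gap P F z) = inn (quantile F) p"
    using lc by (simp_all add: inn_def)
  show "integrable lborel (tail_gap (e l) F)" "(LINT z|lborel. tail_gap (e l) F z) = inn (quantile F) (u l)" if "0 \<le> l"
    using convex_layer_cake[OF F(1) e_props sq_integrable_mult[OF F(2) u_sq[OF that]]] by (simp_all add: inn_def)
  show "tail_gap (h l) F z \<le> tail_gap (e l) F z"
    using convex_env_le[OF h_props(1,2)] e_1 by (intro tail_gap_mono[OF F(1)]) auto
qed

lemma risk_le:
  assumes F: "finite_risk F" and l: "0 \<le> l"
  shows "risk F + 2 * (\<gamma> + l) * inn (quantile F) p \<le> inn (quantile F) (u l)"
proof -
  have F': "is_cdf F" "sq_integrable (quantile F)" and int: "integrable lborel (tail_gap gd F)"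
    using F by (auto simp: finite_risk_def)
  have "(LINT z|lborel. tail_gap gd F z + 2 * (\<gamma> + l) * tail_gap P F z) \<le> (LINT z|lborel. tail_gap (e l) F z)"
    using tail_gap_h_le[OF F', of l] unfolding tail_gap_h
    by (intro integral_mono Bochner_Integration.integrable_add integrable_mult_right int tail_gap_P[OF F'] tail_gap_e[OF F'] l)
  then show ?thesis
    using int tail_gap_P[OF F'] tail_gap_e(2)[OF F' l] by (simp add: risk_def)
qed

lemma riskmetric_finite: "finite_risk F \<Longrightarrow> riskmetric g F = ereal (risk F)"
  using g riskmetric_eq_integral[of F g] by (simp add: finite_risk_def risk_def distortions_def)

text \<open>The envelope of \<open>h 0\<close> supplies the integrable majorant of the tail gap, by
  the square integrability of \<open>u 0\<close>; so only negative parts can diverge.\<close>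

lemma riskmetric_infinite:
  assumes F: "is_cdf F" "sq_integrable (quantile F)" and "\<not> finite_risk F"
  shows "riskmetric g F = - \<infinity>"
proof (rule riskmetric_eq_minus_infinity[OF F(1)])
  show "continuous_on {0..1} g" "g 0 = 0" using g by (auto simp: distortions_def)
  show "\<not> integrable lborel (tail_gap gd F)" using assms by (simp add: finite_risk_def)
  show "integrable lborel (\<lambda>z. tail_gap (e 0) F z - 2 * (\<gamma> + 0) * tail_gap P F z)"
    by (intro Bochner_Integration.integrable_diff integrable_mult_right tail_gap_P[OF F] tail_gap_e[OF F]) simp
  show "tail_gap gd F z \<le> tail_gap (e 0) F z - 2 * (\<gamma> + 0) * tail_gap P F z" for z
    using tail_gap_h_le[OF F, of 0 z] tail_gap_h[of 0 F z] by simp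
qed

text \<open>A level \<open>F z\<close> off the contact set lies inside an interval on which \<open>u l\<close>, and with it the
  quantile function, is constant; but no value of \<open>F\<close> lies inside a flat piece of its quantile
  function.\<close>

lemma risk_eq:
  assumes F: "is_cdf F" and l: "0 \<le> l"
    and q: "\<And>t. t \<in> {0<..<1} \<Longrightarrow> quantile F t = a + b * u l t"
  shows "finite_risk F" and "risk F + 2 * (\<gamma> + l) * inn (quantile F) p = inn (quantile F) (u l)"
proof -
  have "sq_integrable (\<lambda>t. a + b * u l t)"
    by (intro sq_integrable_intros u_sq l)
  then have sq: "sq_integrable (quantile F)"
    using sq_integrable_cong[OF q] by simp
  note F' = F sq
  have contact: "h l (F z) = e l (F z)" for z
  proof (rule ccontr)
    let ?t = "F z"
    assume ne: "h l ?t \<noteq> e l ?t"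
    have bd: "0 \<le> ?t" "?t \<le> 1" using is_cdf_bounds[OF F] by auto
    moreover have "?t \<noteq> 0" "?t \<noteq> 1" using ne e_props(3) e_1 h_props(2) by metis+
    ultimately have t: "0 < ?t" "?t < 1" by auto
    have "e l ?t < h l ?t"
      using convex_env_le[OF h_props(1,2), of ?t l] ne bd by force
    then obtain \<delta> \<alpha> \<beta> where d: "0 < \<delta>" "0 < ?t - \<delta>" "?t + \<delta> < 1"
      "\<And>s. s \<in> {?t-\<delta>..?t+\<delta>} \<Longrightarrow> e l s = \<alpha> + \<beta> * s"
      using convex_env_locally_affine[OF h_props(1,2) t] by metis
    have "u l s = \<beta>" if "?t - \<delta> < s" "s \<le> ?t + \<delta>" for s
      by (rule left_deriv_locally_affine[OF that d(4)])
    then have "u l ?t = u l (?t + \<delta>)" using d by simp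
    then have "quantile F (?t + \<delta>) = quantile F ?t"
      using q[of ?t] q[of "?t + \<delta>"] t d by simp
    moreover have "quantile F ?t \<le> z"
      using quantile_le_iff[OF F t] by simp
    ultimately have "?t + \<delta> \<le> F z"
      using quantile_le_iff[OF F, of "?t + \<delta>" z] d t by simp
    then show False using d by simp
  qed
  have gap: "tail_gap gd F z = tail_gap (e l) F z - 2 * (\<gamma> + l) * tail_gap P F z" for z
  proof -
    have "tail_gap (h l) F z = tail_gap (e l) F z"
      unfolding tail_gap_def contact e_1 ..
    then show ?thesis using tail_gap_h[of l F z] by linarith
  qed
  then have gap': "tail_gap gd F = (\<lambda>z. tail_gap (e l) F z - 2 * (\<gamma> + l) * tail_gap P F z)"
    by (rule ext)
  have "integrable lborel (tail_gap gd F)"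
    unfolding gap' by (intro Bochner_Integration.integrable_diff integrable_mult_right tail_gap_P[OF F'] tail_gap_e[OF F' l])
  then show "finite_risk F" using F' by (simp add: finite_risk_def)
  show "risk F + 2 * (\<gamma> + l) * inn (quantile F) p = inn (quantile F) (u l)"
    unfolding risk_def gap' using tail_gap_P[OF F'] tail_gap_e[OF F' l] by simp
qed

text \<open>For \<open>0 < l\<close> this solves
  \<open>u l t = 2 * l * qopt l t + 2 * \<gamma> * mean (qopt l)\<close>, the stationarity condition
  for \<open>inn q (u l) - l * inn q q - \<gamma> * (mean q)\<^sup>2\<close>. Taking means in it
  yields the mean \<open>\<mu> + g 1 / (2 * (\<gamma> + l))\<close>.\<close>

definition qopt :: "real \<Rightarrow> real \<Rightarrow> real" where
  "qopt l t = \<mu> + g 1 / (2 * (\<gamma> + l)) + (u l t - h l 1) / (2 * l)"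

definition Fopt :: "real \<Rightarrow> real \<Rightarrow> real" where
  "Fopt l = (SOME F. is_cdf F \<and> (\<forall>t\<in>{0<..<1}. quantile F t = qopt l t))"

lemma ex_cdf_affine_u:
  assumes "0 \<le> b"
  shows "\<exists>F. is_cdf F \<and> (\<forall>t\<in>{0<..<1}. quantile F t = a + b * u l t)"
proof (rule ex_cdf_with_quantile)
  show "mono_on {0<..<1} (\<lambda>t. a + b * u l t)"
    using assms by (intro mono_onI add_left_mono mult_left_mono mono_onD[OF u_mono])
  show "((\<lambda>t. a + b * u l t) \<longlongrightarrow> a + b * u l t) (at_left t)" if "0 < t" "t < 1" for t
    by (intro tendsto_intros u_left_cont that)
qed

lemma qopt_affine: "qopt l t = (\<mu> + g 1 / (2 * (\<gamma> + l)) - h l 1 / (2 * l)) + 1 / (2 * l) * u l t"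
  by (simp add: qopt_def diff_divide_distrib)

lemma Fopt:
  assumes "0 < l"
  shows "is_cdf (Fopt l)" "\<And>t. t \<in> {0<..<1} \<Longrightarrow> quantile (Fopt l) t = qopt l t"
proof -
  have "\<exists>F. is_cdf F \<and> (\<forall>t\<in>{0<..<1}. quantile F t = qopt l t)"
    unfolding qopt_affine using assms by (intro ex_cdf_affine_u) simp
  from someI_ex[OF this]
  show "is_cdf (Fopt l)" "\<And>t. t \<in> {0<..<1} \<Longrightarrow> quantile (Fopt l) t = qopt l t"
    unfolding Fopt_def by auto
qed

lemma qopt_sq: "0 < l \<Longrightarrow> sq_integrable (qopt l)"
  unfolding qopt_affine[abs_def] by (intro sq_integrable_intros u_sq) simp

lemma qopt_mean:
  assumes "0 < l"
  shows "(LINT t|unif. qopt l t) = \<mu> + g 1 / (2 * (\<gamma> + l))"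
proof -
  have "integrable unif (u l)" using sq_integrable_integrable[OF u_sq] assms by simp
  then show ?thesis
    unfolding qopt_affine using u_mean[of l] unif.prob_space by (simp add: field_simps)
qed

section \<open>The Lagrangian and its dual function\<close>

definition mean :: "(real \<Rightarrow> real) \<Rightarrow> real" where
  "mean q = (LINT t|unif. q t)"

definition lagr :: "(real \<Rightarrow> real) \<Rightarrow> real \<Rightarrow> real" where
  "lagr F l = risk F + \<gamma> * (inn (quantile F) (quantile F) - (mean (quantile F))\<^sup>2)
     - (\<gamma> + l) * (inn (\<lambda>t. quantile F t - p t) (\<lambda>t. quantile F t - p t) - \<epsilon>)"

text \<open>The value of the quadratic functional at its stationary point \<open>qopt l\<close>,
  together with the part of the Lagrangian that does not depend on the quantile function.\<close>

definition dual :: "real \<Rightarrow> real" where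
  "dual l = l * inn (qopt l) (qopt l) + \<gamma> * (mean (qopt l))\<^sup>2 - (\<gamma> + l) * (inn p p - \<epsilon>)"

lemma mean_eq_inn: "mean q = inn (\<lambda>_. 1) q"
  by (simp add: mean_def inn_def)

text \<open>The stationarity condition that defines \<open>qopt l\<close>, tested against
  \<open>q\<close>.\<close>

lemma inn_u:
  assumes l: "0 < l" and q: "sq_integrable q"
  shows "inn q (u l) = 2 * l * inn q (qopt l) + 2 * \<gamma> * mean q * mean (qopt l)"
proof -
  have m: "mean (qopt l) = \<mu> + g 1 / (2 * (\<gamma> + l))"
    using qopt_mean[OF l] by (simp add: mean_def)
  have gl: "\<gamma> + l > 0" using l gamma_pos by simp
  define M where "M = mean (qopt l)"
  have h1: "h l 1 = 2 * (\<gamma> + l) * M"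
    unfolding M_def m h_props(3) using gl by (simp add: distrib_left)
  have "2 * l * qopt l t = 2 * l * M + (u l t - 2 * (\<gamma> + l) * M)" for t
    unfolding qopt_def m[symmetric] M_def[symmetric] h1 using l by (simp add: distrib_left)
  then have "u l t = 2 * l * qopt l t + 2 * \<gamma> * M * 1" for t
    by (simp add: algebra_simps)
  then have u: "u l = (\<lambda>t. 2 * l * qopt l t + 2 * \<gamma> * mean (qopt l) * 1)"
    unfolding M_def by (rule ext)
  have "inn q (u l) = inn q (\<lambda>t. 2 * l * qopt l t) + inn q (\<lambda>t. 2 * \<gamma> * mean (qopt l) * 1)"
    unfolding u by (rule inn_add_right) (intro sq_integrable_intros qopt_sq l q)+
  also have "\<dots> = 2 * l * inn q (qopt l) + 2 * \<gamma> * mean (qopt l) * mean q"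
    unfolding inn_cmult_right mean_eq_inn[of q] by (simp add: inn_commute[of _ q])
  finally show ?thesis by simp
qed

text \<open>Completed squares in the quantile function and in its mean; the last bracket is the loss
  in passing from \<open>h l\<close> to its envelope. For finite risk all three subtracted terms are
  nonnegative, and all vanish at \<open>Fopt l\<close>.\<close>

lemma lagr_identity:
  assumes l: "0 < l" and F: "sq_integrable (quantile F)"
  shows "lagr F l = dual l - l * inn (\<lambda>t. quantile F t - qopt l t) (\<lambda>t. quantile F t - qopt l t)
      - \<gamma> * (mean (quantile F) - mean (qopt l))\<^sup>2
      - (inn (quantile F) (u l) - risk F - 2 * (\<gamma> + l) * inn (quantile F) p)"
  unfolding lagr_def dual_def inn_u[OF l F] sq_dist_expand[OF F p_sq] sq_dist_expand[OF F qopt_sq[OF l]]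
  by (simp add: power2_eq_square algebra_simps)

lemma lagr_le:
  assumes l: "0 < l" and F: "finite_risk F"
  shows "lagr F l \<le> dual l - l * inn (\<lambda>t. quantile F t - qopt l t) (\<lambda>t. quantile F t - qopt l t)"
proof -
  have "sq_integrable (quantile F)" using F by (simp add: finite_risk_def)
  moreover have "0 \<le> \<gamma> * (mean (quantile F) - mean (qopt l))\<^sup>2" using gamma_pos by simp
  ultimately show ?thesis
    using lagr_identity[OF l, of F] risk_le[OF F, of l] l by linarith
qed

lemma Fopt_finite_risk: "0 < l \<Longrightarrow> finite_risk (Fopt l)"
  by (rule risk_eq(1)[OF Fopt(1) less_imp_le Fopt(2)[unfolded qopt_affine]])

lemma lagr_Fopt:
  assumes l: "0 < l"
  shows "lagr (Fopt l) l = dual l"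
proof -
  have sq: "sq_integrable (quantile (Fopt l))"
    using Fopt_finite_risk[OF l] by (simp add: finite_risk_def)
  have eq: "risk (Fopt l) + 2 * (\<gamma> + l) * inn (quantile (Fopt l)) p = inn (quantile (Fopt l)) (u l)"
    by (rule risk_eq(2)[OF Fopt(1)[OF l] less_imp_le[OF l] Fopt(2)[OF l, unfolded qopt_affine]])
  have "inn (\<lambda>t. quantile (Fopt l) t - qopt l t) (\<lambda>t. quantile (Fopt l) t - qopt l t) = inn (\<lambda>_. 0) (\<lambda>_. 0)"
    by (rule inn_cong) (simp_all add: Fopt(2)[OF l])
  moreover have "mean (quantile (Fopt l)) = mean (qopt l)"
    unfolding mean_eq_inn by (rule inn_cong) (simp_all add: Fopt(2)[OF l])
  ultimately show ?thesis
    unfolding lagr_identity[OF l sq] using eq by (simp add: inn_def)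
qed

section \<open>A multiplier with a tight constraint\<close>

lemma lagr_le_dual:
  assumes l: "0 < l" and F: "finite_risk F"
  shows "lagr F l \<le> dual l"
proof -
  have "0 \<le> l * inn (\<lambda>t. quantile F t - qopt l t) (\<lambda>t. quantile F t - qopt l t)"
    using l inn_self_nonneg by (intro mult_nonneg_nonneg) auto
  then show ?thesis using lagr_le[OF assms] by simp
qed

definition slack :: "real \<Rightarrow> real" where
  "slack l = \<epsilon> - inn (\<lambda>t. qopt l t - p t) (\<lambda>t. qopt l t - p t)"

text \<open>For a fixed CDF the Lagrangian is affine in the multiplier; its slope is
  \<open>\<epsilon>\<close> minus the squared distance to \<open>G\<close>.\<close>

lemma lagr_Fopt_shift:
  assumes "0 < l"
  shows "lagr (Fopt l) l' = dual l + (l' - l) * slack l"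
proof -
  have N: "inn (\<lambda>t. quantile (Fopt l) t - p t) (\<lambda>t. quantile (Fopt l) t - p t) = \<epsilon> - slack l"
    unfolding slack_def by (simp, rule inn_cong) (simp_all add: Fopt(2)[OF assms])
  have "lagr (Fopt l) l' = lagr (Fopt l) l + (l' - l) * slack l"
    unfolding lagr_def N by (simp add: algebra_simps)
  then show ?thesis by (simp add: lagr_Fopt[OF assms])
qed

lemma dual_subgradient:
  assumes "0 < l" "0 < l'"
  shows "dual l + (l' - l) * slack l + l' * inn (\<lambda>t. qopt l t - qopt l' t) (\<lambda>t. qopt l t - qopt l' t) \<le> dual l'"
proof -
  have "inn (\<lambda>t. quantile (Fopt l) t - qopt l' t) (\<lambda>t. quantile (Fopt l) t - qopt l' t)
      = inn (\<lambda>t. qopt l t - qopt l' t) (\<lambda>t. qopt l t - qopt l' t)"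
    by (rule inn_cong) (simp_all add: Fopt(2)[OF assms(1)])
  then show ?thesis
    using lagr_le[OF assms(2) Fopt_finite_risk[OF assms(1)]] lagr_Fopt_shift[OF assms(1), of l'] by simp
qed

text \<open>Adding the inequalities of \<open>dual_subgradient\<close> in both directions bounds the
  squared distance \<open>D\<close> of the two optimal quantile functions by a multiple of the slack
  difference \<open>w\<close>. A Cauchy-Schwarz estimate of \<open>w\<close> in terms of
  \<open>D\<close> closes the loop.\<close>

lemma
  assumes l: "0 < l'" "l' < l"
  shows slack_mono: "slack l' \<le> slack l"
    and slack_increment: "slack l - slack l' \<le> (l - l') / (l + l') * (4 * (\<epsilon> - slack l'))"
proof -
  define A where "A = (\<lambda>t. qopt l' t - p t)"
  define B where "B = (\<lambda>t. qopt l t - p t)"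
  have sq: "sq_integrable A" "sq_integrable B"
    using l by (auto simp: A_def B_def intro!: sq_integrable_diff qopt_sq p_sq)
  have N: "inn A A = \<epsilon> - slack l'" "inn B B = \<epsilon> - slack l"
    by (simp_all add: A_def B_def slack_def)
  define D where "D = inn A A - 2 * inn A B + inn B B"
  define E where "E = inn A A + 2 * inn A B + inn B B"
  define w where "w = slack l - slack l'"
  have "inn (\<lambda>t. A t - B t) (\<lambda>t. A t - B t) = D"
    unfolding D_def by (rule sq_dist_expand[OF sq])
  then have D': "inn (\<lambda>t. qopt l' t - qopt l t) (\<lambda>t. qopt l' t - qopt l t) = D"
    by (simp add: A_def B_def)
  have "inn (\<lambda>t. B t - A t) (\<lambda>t. B t - A t) = D"
    unfolding D_def sq_dist_expand[OF sq(2,1)] by (simp add: inn_commute)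
  then have D'': "inn (\<lambda>t. qopt l t - qopt l' t) (\<lambda>t. qopt l t - qopt l' t) = D"
    by (simp add: A_def B_def)
  have D0: "0 \<le> D" using inn_self_nonneg D' by metis
  have "0 \<le> (l - l') * w - (l + l') * D"
    using dual_subgradient[of l' l] dual_subgradient[of l l'] l unfolding D' D'' w_def
    by (simp add: algebra_simps)
  then have DW: "(l + l') * D \<le> (l - l') * w" by simp
  have "0 \<le> (l + l') * D" using D0 l by simp
  then have w0: "0 \<le> w" using DW l by (smt (verit) mult_pos_neg)
  then show "slack l' \<le> slack l" by (simp add: w_def)
  \<comment> \<open>The factor for which \<open>D \<le> \<theta> * w\<close>. It also weights the
    square below, a form of Cauchy-Schwarz for \<open>w\<close>, which is the inner product of
    \<open>A - B\<close> and \<open>A + B\<close>.\<close>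
  define \<theta> where "\<theta> = (l - l') / (l + l')"
  have \<theta>: "0 < \<theta>" using l by (simp add: \<theta>_def)
  have D\<theta>: "D \<le> \<theta> * w"
    using DW l by (simp add: \<theta>_def field_simps)
  have "0 \<le> inn (\<lambda>t. (A t - B t) - \<theta> * (A t + B t)) (\<lambda>t. (A t - B t) - \<theta> * (A t + B t))"
    by (rule inn_self_nonneg)
  also have "\<dots> = D - 2 * \<theta> * (inn A A - inn B B) + \<theta>\<^sup>2 * E"
    using sq by (simp add: inn_left inn_right sq_integrable_intros D_def E_def inn_commute[of B A]
        power2_eq_square algebra_simps)
  also have "inn A A - inn B B = w" by (simp add: N w_def)
  finally have "2 * \<theta> * w \<le> D + \<theta>\<^sup>2 * E" by simp
  with D\<theta> have "\<theta> * w \<le> \<theta> * (\<theta> * E)" by (simp add: power2_eq_square)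
  then have wE: "w \<le> \<theta> * E" using \<theta> by simp
  \<comment> \<open>The parallelogram law with \<open>0 \<le> D\<close>; next,
    \<open>0 \<le> w\<close> bounds \<open>inn B B\<close> by \<open>inn A A\<close>.\<close>
  have "E \<le> 2 * inn A A + 2 * inn B B" using D0 by (simp add: D_def E_def)
  also have "\<dots> \<le> 4 * (\<epsilon> - slack l')" using w0 by (simp add: N w_def)
  finally have "\<theta> * E \<le> \<theta> * (4 * (\<epsilon> - slack l'))" using \<theta> by (intro mult_left_mono) auto
  with wE show "slack l - slack l' \<le> (l - l') / (l + l') * (4 * (\<epsilon> - slack l'))"
    by (simp add: w_def \<theta>_def)
qed

lemma slack_continuous:
  assumes a: "0 < a"
  shows "continuous_on {a..} slack"
proof -
  \<comment> \<open>A Lipschitz constant on \<open>{a..}\<close>: in \<open>slack_increment\<close>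
    the sum of the multipliers is at least \<open>2 * a\<close>, and
    \<open>\<epsilon> - slack x\<close> is largest at \<open>a\<close>.\<close>
  define C where "C = 2 * (\<epsilon> - slack a) / a"
  have N0: "0 \<le> \<epsilon> - slack l" for l by (simp add: slack_def inn_self_nonneg)
  have mono: "slack x \<le> slack y" if "a \<le> x" "x \<le> y" for x y
    using slack_mono[of x y] that a by (cases "x = y") auto
  have lip: "slack y - slack x \<le> C * (y - x)" if "a \<le> x" "x < y" for x y
  proof -
    have "slack y - slack x \<le> (y - x) / (y + x) * (4 * (\<epsilon> - slack x))"
      using that a by (intro slack_increment) auto
    also have "\<dots> \<le> (y - x) / (2 * a) * (4 * (\<epsilon> - slack a))"
      using that a N0[of x] mono[of a x] by (intro mult_mono divide_left_mono) auto
    also have "\<dots> = C * (y - x)" using a by (simp add: C_def field_simps)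
    finally show ?thesis .
  qed
  have "C-lipschitz_on {a..} slack"
  proof (rule lipschitz_onI)
    show "0 \<le> C" using N0[of a] a by (simp add: C_def)
    fix x y assume "x \<in> {a..}" "y \<in> {a..}"
    then show "dist (slack x) (slack y) \<le> C * dist x y"
      using lip[of x y] lip[of y x] mono[of x y] mono[of y x]
      by (cases x y rule: linorder_cases) (auto simp: dist_real_def)
  qed
  then show ?thesis by (rule lipschitz_on_continuous_on)
qed

section \<open>Growth of the dual function at both ends\<close>

lemma h0_spread:
  defines "r \<equiv> \<lambda>t. u 0 t - h 0 1"
  shows "sq_integrable r" "mean r = 0" "0 < inn r r"
proof -
  have u0: "sq_integrable (u 0)" by (rule u_sq) simp
  show sq: "sq_integrable r"
    unfolding r_def by (intro sq_integrable_intros u0)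
  show "mean r = 0"
    using sq_integrable_integrable[OF u0] u_mean[of 0] unif.prob_space by (simp add: mean_def r_def)
  have "inn r r \<noteq> 0"
  proof
    assume "inn r r = 0"
    from inn_self_eq_0[OF sq this] have ae: "AE t in unif. u 0 t = h 0 1"
      by (simp add: r_def)
    have "u 0 t = h 0 1" if "t \<in> {0<..<1}" for t
      using that by (intro AE_unif_eq_left_cont[OF ae] u_left_cont) auto
    then have "u 0 constant_on {0<..<1}" unfolding constant_on_def by blast
    then show False using not_constant[of 0] by simp
  qed
  then show "0 < inn r r" using inn_self_nonneg[of r] by simp
qed

text \<open>The test distributions have quantile functions proportional to the centred \<open>u 0\<close>; for the
  factor \<open>\<alpha>\<close> the Lagrangian is evaluated at \<open>l = 1 / \<alpha>\<^sup>2\<close>, where it grows linearly in \<open>\<alpha>\<close>.\<close>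

lemma dual_large_near_0: "\<exists>l. 0 < l \<and> l < 1 \<and> C < dual l"
proof -
  have inv: "0 < 1 / x" "1 / x < 1" if "1 < x" for x :: real using that by simp_all
  define r where "r = (\<lambda>t. u 0 t - h 0 1)"
  note r = h0_spread[folded r_def]
  define B where "B = inn r r"
  define c where "c = inn r p"
  define K where "K = inn p p - \<epsilon>"
  have B: "0 < B" using r(3) by (simp add: B_def)
  have lower: "\<alpha> * B - 2 * \<bar>c\<bar> - B - (\<gamma> + 1) * \<bar>K\<bar> \<le> dual (1 / \<alpha>\<^sup>2)" if \<alpha>: "1 < \<alpha>" for \<alpha>
  proof -
    define l where "l = 1 / \<alpha>\<^sup>2"
    have "1 < \<alpha>\<^sup>2" using \<alpha> by simp
    then have l: "0 < l" "l < 1"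
      unfolding l_def by (rule inv)+
    have l\<alpha>: "l * \<alpha>\<^sup>2 = 1" "l * \<alpha> \<le> 1"
      using \<alpha> by (auto simp: l_def power2_eq_square)
    have "\<exists>F. is_cdf F \<and> (\<forall>t\<in>{0<..<1}. quantile F t = - \<alpha> * h 0 1 + \<alpha> * u 0 t)"
      using \<alpha> by (intro ex_cdf_affine_u) simp
    then obtain F where F: "is_cdf F" "\<And>t. t \<in> {0<..<1} \<Longrightarrow> quantile F t = - \<alpha> * h 0 1 + \<alpha> * u 0 t"
      by blast
    \<comment> \<open>As the quantile function is affine in \<open>u 0\<close>, the bound at
      multiplier 0 is an equality and the risk of \<open>F\<close> is known exactly.\<close>
    note risk = risk_eq[OF F(1) order_refl F(2)]
    have q: "quantile F t = \<alpha> * r t" if "t \<in> {0<..<1}" for t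
      using F(2)[OF that] by (simp add: r_def algebra_simps)
    have u0: "u 0 = (\<lambda>t. r t + h 0 1 * 1)" by (simp add: r_def)
    have "inn r (u 0) = inn r r + inn r (\<lambda>t. h 0 1 * 1)"
      unfolding u0 by (rule inn_add_right) (intro r sq_integrable_intros)+
    also have "inn r (\<lambda>t. h 0 1 * 1) = 0"
      unfolding inn_cmult_right using r(2) by (simp add: mean_eq_inn inn_commute[of r])
    finally have ru: "inn r (u 0) = B" by (simp add: B_def)
    have "inn (quantile F) (u 0) = inn (\<lambda>t. \<alpha> * r t) (u 0)" by (rule inn_cong) (simp_all add: q)
    then have qu: "inn (quantile F) (u 0) = \<alpha> * B" by (simp add: inn_cmult_left ru)
    have "inn (quantile F) p = inn (\<lambda>t. \<alpha> * r t) p" by (rule inn_cong) (simp_all add: q)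
    then have qp: "inn (quantile F) p = \<alpha> * c" by (simp add: inn_cmult_left c_def)
    have "inn (quantile F) (quantile F) = inn (\<lambda>t. \<alpha> * r t) (\<lambda>t. \<alpha> * r t)" by (rule inn_cong) (simp_all add: q)
    then have qq: "inn (quantile F) (quantile F) = \<alpha>\<^sup>2 * B"
      by (simp add: inn_cmult_left inn_cmult_right B_def power2_eq_square)
    have "inn (\<lambda>_. 1) (quantile F) = inn (\<lambda>_. 1) (\<lambda>t. \<alpha> * r t)" by (rule inn_cong) (simp_all add: q)
    then have qm: "mean (quantile F) = 0"
      using r(2) by (simp add: mean_eq_inn inn_cmult_right)
    have sqF: "sq_integrable (quantile F)" using risk(1) by (simp add: finite_risk_def)
    have "risk F = \<alpha> * B - 2 * \<gamma> * (\<alpha> * c)"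
      using risk(2) by (simp add: qu qp)
    then have "lagr F l = \<alpha> * B - 2 * \<gamma> * (\<alpha> * c) + \<gamma> * (\<alpha>\<^sup>2 * B) - (\<gamma> + l) * (\<alpha>\<^sup>2 * B - 2 * (\<alpha> * c) + K)"
      unfolding lagr_def sq_dist_expand[OF sqF p_sq] qm qq qp K_def by (simp add: algebra_simps)
    \<comment> \<open>The terms carrying both \<open>\<gamma>\<close> and \<open>\<alpha>\<close>
      cancel. Since \<open>l * \<alpha>\<^sup>2 = 1\<close>, the remaining quadratic cost is the
      constant \<open>B\<close>, against the gain \<open>\<alpha> * B\<close>.\<close>
    also have "\<dots> = \<alpha> * B + 2 * c * (l * \<alpha>) - (l * \<alpha>\<^sup>2) * B - (\<gamma> + l) * K"
      by (simp add: algebra_simps)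
    finally have L: "lagr F l = \<alpha> * B + 2 * c * (l * \<alpha>) - B - (\<gamma> + l) * K"
      by (simp add: l\<alpha>)
    have "\<bar>c * (l * \<alpha>)\<bar> \<le> \<bar>c\<bar> * 1"
      unfolding abs_mult using l \<alpha> l\<alpha>(2) by (intro mult_left_mono) (auto simp: abs_mult)
    moreover have "\<bar>(\<gamma> + l) * K\<bar> \<le> (\<gamma> + 1) * \<bar>K\<bar>"
      unfolding abs_mult using l gamma_pos by (intro mult_right_mono) auto
    ultimately have "\<alpha> * B - 2 * \<bar>c\<bar> - B - (\<gamma> + 1) * \<bar>K\<bar> \<le> lagr F l"
      unfolding L by linarith
    also have "\<dots> \<le> dual l"
      by (rule lagr_le_dual[OF l(1) risk(1)])
    finally show ?thesis by (simp add: l_def)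
  qed
  define \<alpha> where "\<alpha> = max 2 ((\<bar>C\<bar> + 2 * \<bar>c\<bar> + B + (\<gamma> + 1) * \<bar>K\<bar> + 1) / B)"
  have "1 < \<alpha>" by (simp add: \<alpha>_def)
  have "(\<bar>C\<bar> + 2 * \<bar>c\<bar> + B + (\<gamma> + 1) * \<bar>K\<bar> + 1) / B \<le> \<alpha>" by (simp add: \<alpha>_def)
  then have "\<bar>C\<bar> + 2 * \<bar>c\<bar> + B + (\<gamma> + 1) * \<bar>K\<bar> + 1 \<le> \<alpha> * B" using B by (simp add: divide_le_eq)
  then have "C < dual (1 / \<alpha>\<^sup>2)" using lower[OF \<open>1 < \<alpha>\<close>] by linarith
  moreover have "1 < \<alpha>\<^sup>2" using \<open>1 < \<alpha>\<close> by simp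
  ultimately show ?thesis using inv[of "\<alpha>\<^sup>2"] by blast
qed

text \<open>\<open>F\<close> is 0 left of \<open>- n\<close> and 1 from \<open>n\<close> on, so the
  tail gap is bounded and vanishes outside a compact interval.\<close>

lemma finite_risk_bounded:
  assumes F: "is_cdf F" and n: "\<And>t. t \<in> {0<..<1} \<Longrightarrow> \<bar>quantile F t\<bar> \<le> n"
  shows "finite_risk F"
proof -
  have n0: "0 \<le> n" using n[of "1/2"] by auto
  have [measurable]: "quantile F \<in> borel_measurable unif" by (rule quantile_measurable[OF F])
  have bound: "AE t in unif. norm ((quantile F t)\<^sup>2) \<le> n\<^sup>2"
    using power_mono[OF n, of _ 2] by (intro AE_I2) simp
  have "integrable unif (\<lambda>t. (quantile F t)\<^sup>2)"
    by (rule unif.integrable_const_bound[OF bound]) measurable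
  then have sq: "sq_integrable (quantile F)" by (simp add: sq_integrable_def)
  have F1: "F z = 1" if "n \<le> z" for z
  proof (rule ccontr)
    assume "F z \<noteq> 1"
    then have lt: "F z < 1" using is_cdf_bounds[OF F, of z] by simp
    let ?t = "(1 + F z) / 2"
    have t: "0 < ?t" "?t < 1" using lt is_cdf_bounds(1)[OF F, of z] by auto
    have "quantile F ?t \<le> z" using n[of ?t] t that by auto
    then have "?t \<le> F z" using quantile_le_iff[OF F t] by simp
    then show False using lt by simp
  qed
  have F0: "F z = 0" if "z < - n" for z
  proof (rule ccontr)
    assume "F z \<noteq> 0"
    then have lt: "0 < F z" using is_cdf_bounds[OF F, of z] by simp
    let ?t = "F z / 2"
    have t: "0 < ?t" "?t < 1" using lt is_cdf_bounds(2)[OF F, of z] by auto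
    have "quantile F ?t \<le> z" using quantile_le_iff[OF F t, of z] lt by simp
    then show False using n[of ?t] t that by auto
  qed
  obtain b where b: "\<And>t. t \<in> {0..1} \<Longrightarrow> \<bar>gd t\<bar> \<le> b"
  proof -
    have "bounded (gd ` {0..1})"
      using gd(1) by (intro compact_imp_bounded compact_continuous_image) auto
    then obtain b where "\<forall>x\<in>gd ` {0..1}. norm x \<le> b" unfolding bounded_iff by blast
    then show ?thesis by (intro that[of b]) auto
  qed
  have b0: "0 \<le> b" using b[of 0] by auto
  have "integrable lborel (tail_gap gd F)"
  proof (rule Bochner_Integration.integrable_bound)
    show "integrable lborel (\<lambda>z. indicator {-n..n} z * (2 * b))"
      using n0 by (intro integrable_mult_left integrable_real_indicator) auto
    show "tail_gap gd F \<in> borel_measurable lborel"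
      using tail_gap_measurable[OF gd(1) F] by simp
    show "AE z in lborel. norm (tail_gap gd F z) \<le> norm (indicator {-n..n} z * (2 * b))"
    proof (rule AE_I2)
      fix z
      have "\<bar>gd (F z)\<bar> \<le> b" "\<bar>gd 1\<bar> \<le> b" using b is_cdf_bounds[OF F, of z] by auto
      then have "\<bar>tail_gap gd F z\<bar> \<le> 2 * b" by (auto simp: tail_gap_def)
      moreover have "tail_gap gd F z = 0" if "z \<notin> {-n..n}"
        using that F0[of z] F1[of z] n0 gd(2) by (cases "z < - n") (auto simp: tail_gap_def)
      ultimately show "norm (tail_gap gd F z) \<le> norm (indicator {-n..n} z * (2 * b))"
        using b0 by (cases "z \<in> {-n..n}") auto
    qed
  qed
  with F sq show ?thesis by (simp add: finite_risk_def)
qed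

text \<open>A strictly feasible point of finite risk. Since the riskmetric of \<open>G\<close> may
  be minus infinity, truncations of its quantile function are used; they converge to it in mean
  square by dominated convergence.\<close>

lemma ex_bounded_near:
  "\<exists>F. finite_risk F \<and> inn (\<lambda>t. quantile F t - p t) (\<lambda>t. quantile F t - p t) < \<epsilon>"
proof -
  have [measurable]: "p \<in> borel_measurable unif" by (rule quantile_measurable[OF cdf_G])
  define w where "w n t = max (- real n) (min (real n) (p t))" for n :: nat and t
  have [measurable]: "w n \<in> borel_measurable unif" for n
    unfolding w_def[abs_def] by measurable
  have "(\<lambda>n. LINT t|unif. (w n t - p t)\<^sup>2) \<longlonglongrightarrow> (LINT t|unif. 0)"
  proof (rule integral_dominated_convergence[where w = "\<lambda>t. (p t)\<^sup>2"])
    show "integrable unif (\<lambda>t. (p t)\<^sup>2)" using p_sq by (simp add: sq_integrable_def)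
    show "AE t in unif. (\<lambda>n. (w n t - p t)\<^sup>2) \<longlonglongrightarrow> 0"
    proof (rule AE_I2)
      fix t
      have "\<forall>\<^sub>F n in sequentially. w n t = p t"
      proof (rule eventually_sequentiallyI)
        show "w n t = p t" if "nat \<lceil>\<bar>p t\<bar>\<rceil> \<le> n" for n
          using that unfolding w_def by linarith
      qed
      then have "\<forall>\<^sub>F n in sequentially. (w n t - p t)\<^sup>2 = 0"
        by eventually_elim simp
      then show "(\<lambda>n. (w n t - p t)\<^sup>2) \<longlonglongrightarrow> 0"
        by (rule tendsto_eventually)
    qed
    show "AE t in unif. norm ((w n t - p t)\<^sup>2) \<le> (p t)\<^sup>2" for n
    proof (rule AE_I2)
      fix t
      have "\<bar>w n t - p t\<bar> \<le> \<bar>p t\<bar>" unfolding w_def by linarith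
      then show "norm ((w n t - p t)\<^sup>2) \<le> (p t)\<^sup>2" by (simp add: abs_le_square_iff)
    qed
  qed measurable
  then have "\<forall>\<^sub>F n in sequentially. (LINT t|unif. (w n t - p t)\<^sup>2) < \<epsilon>"
    using eps_pos by (intro order_tendstoD) auto
  then obtain n where n: "(LINT t|unif. (w n t - p t)\<^sup>2) < \<epsilon>"
    by (auto dest: eventually_happens)
  have "mono_on {0<..<1} (w n)"
    unfolding w_def by (intro mono_onI max.mono min.mono order_refl mono_onD[OF quantile_mono[OF cdf_G]])
  moreover have "(w n \<longlongrightarrow> w n t) (at_left t)" if "0 < t" "t < 1" for t
    unfolding w_def[abs_def] by (intro tendsto_intros quantile_left_cont[OF cdf_G that])
  ultimately obtain F where F: "is_cdf F" "\<And>t. t \<in> {0<..<1} \<Longrightarrow> quantile F t = w n t"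
    using ex_cdf_with_quantile by blast
  have "finite_risk F"
  proof (rule finite_risk_bounded[OF F(1)])
    show "\<bar>quantile F t\<bar> \<le> real n" if "t \<in> {0<..<1}" for t
      unfolding F(2)[OF that] w_def by linarith
  qed
  moreover have "inn (\<lambda>t. quantile F t - p t) (\<lambda>t. quantile F t - p t) = (LINT t|unif. (w n t - p t)\<^sup>2)"
    unfolding inn_def by (rule Bochner_Integration.integral_cong) (simp_all add: F(2) power2_eq_square)
  ultimately show ?thesis using n by auto
qed

text \<open>At a strictly feasible \<open>F\<close> the Lagrangian, which bounds \<open>dual\<close>
  from below, is affine in \<open>l\<close> with the positive slope \<open>d\<close>.\<close>

lemma dual_large_at_infinity: "\<exists>l. 1 < l \<and> C < dual l"
proof -
  obtain F where F: "finite_risk F" and lt: "inn (\<lambda>t. quantile F t - p t) (\<lambda>t. quantile F t - p t) < \<epsilon>"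
    using ex_bounded_near by blast
  define d where "d = \<epsilon> - inn (\<lambda>t. quantile F t - p t) (\<lambda>t. quantile F t - p t)"
  define A where "A = risk F + \<gamma> * (inn (quantile F) (quantile F) - (mean (quantile F))\<^sup>2)"
  have d: "0 < d" using lt by (simp add: d_def)
  have L: "lagr F l = A + (\<gamma> + l) * d" for l
    by (simp add: lagr_def A_def d_def algebra_simps)
  define l where "l = max 2 ((\<bar>A\<bar> + \<bar>C\<bar> + 1) / d)"
  have l: "1 < l" by (simp add: l_def)
  have "(\<bar>A\<bar> + \<bar>C\<bar> + 1) / d \<le> l" by (simp add: l_def)
  then have "\<bar>A\<bar> + \<bar>C\<bar> + 1 \<le> l * d" using d by (simp add: divide_le_eq)
  moreover have "0 < \<gamma> * d" using gamma_pos d by simp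
  ultimately have "C < lagr F l" unfolding L distrib_right by linarith
  also have "\<dots> \<le> dual l"
    using l by (intro lagr_le_dual F) simp
  finally show ?thesis using l by blast
qed

lemma ex_zero_slack: "\<exists>l>0. slack l = 0"
proof -
  obtain a where a: "0 < a" "a < 1" "dual 1 < dual a" using dual_large_near_0 by blast
  obtain b where b: "1 < b" "dual 1 < dual b" using dual_large_at_infinity by blast
  \<comment> \<open>The subgradient inequality at \<open>l\<close>, evaluated at 1. As
    \<open>dual\<close> is larger at \<open>a < 1\<close> and at \<open>b > 1\<close> than at 1, it
    fixes the sign of the slack at both points.\<close>
  have sub: "(l - 1) * slack l \<ge> dual l - dual 1" if "0 < l" for l
  proof -
    have "0 \<le> 1 * inn (\<lambda>t. qopt l t - qopt 1 t) (\<lambda>t. qopt l t - qopt 1 t)"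
      using inn_self_nonneg by simp
    then show ?thesis using dual_subgradient[OF that, of 1] by (simp add: algebra_simps)
  qed
  have "0 < (a - 1) * slack a" using sub[of a] a by linarith
  then have sa: "slack a \<le> 0" using a by (simp add: zero_less_mult_iff)
  have "0 < (b - 1) * slack b" using sub[of b] b by linarith
  then have sb: "0 \<le> slack b" using b by (simp add: zero_less_mult_iff)
  have "continuous_on {a..b} slack"
    by (rule continuous_on_subset[OF slack_continuous[OF a(1)]]) auto
  then obtain l where "a \<le> l" "l \<le> b" "slack l = 0"
    using IVT'[of slack a 0 b] sa sb a b by auto
  with a show ?thesis by (intro exI[of _ l]) auto
qed

section \<open>Uniqueness and optimality\<close>

text \<open>If two multipliers gave the same optimal quantile function, with antiderivative \<open>Q\<close>, then
  \<open>g 1 = 0\<close> and \<open>P \<le> Q\<close>: where \<open>P\<close> exceeds \<open>Q\<close>, the larger multiplier is off contact, so \<open>Q\<close> is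
  locally affine and the convex function \<open>P - Q\<close> has no leftmost interior maximum. This pushes \<open>h 0\<close>
  above its chord, contrary to the assumption at multiplier 0.\<close>

lemma qopt_inj:
  assumes l: "0 < l1" "l1 < l2"
    and eq: "\<And>t. t \<in> {0<..<1} \<Longrightarrow> qopt l1 t = qopt l2 t"
  shows False
proof -
  have l2: "0 < l2" using l by simp
  have "mean (qopt l1) = mean (qopt l2)"
    unfolding mean_eq_inn by (rule inn_cong) (simp_all add: eq)
  then have "g 1 / (2 * (\<gamma> + l1)) = g 1 / (2 * (\<gamma> + l2))"
    using qopt_mean[OF l(1)] qopt_mean[OF l2] by (simp add: mean_def)
  then have "g 1 * (2 * (\<gamma> + l2)) = g 1 * (2 * (\<gamma> + l1))"
    using l l2 gamma_pos by (simp add: frac_eq_eq)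
  then have g1: "g 1 = 0"
    using l gamma_pos by simp
  have h1: "h l 1 = 2 * (\<gamma> + l) * \<mu>" for l by (simp add: h_props(3) g1)
  have u_q: "u l t = 2 * l * qopt l t + 2 * \<gamma> * \<mu>" if "0 < l" for l t
  proof -
    have "2 * l * qopt l t = 2 * l * \<mu> + (u l t - h l 1)"
      unfolding qopt_def g1 using that by (simp add: distrib_left)
    then show ?thesis by (simp add: h1 algebra_simps)
  qed
  \<comment> \<open>The antiderivative, vanishing at 0, of the common quantile function, written
    with \<open>e l1\<close>. That \<open>e l2\<close> has the same form is where the equality of
    the two quantile functions enters.\<close>
  define Q where "Q s = (e l1 s - 2 * \<gamma> * \<mu> * s) / (2 * l1)" for s
  have e_Q1: "e l1 s = 2 * l1 * Q s + 2 * \<gamma> * \<mu> * s" for s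
    using l by (simp add: Q_def)
  have e_Q2: "e l2 s = 2 * l2 * Q s + 2 * \<gamma> * \<mu> * s" if s: "0 \<le> s" "s \<le> 1" for s
  proof -
    have u_int: "set_integrable lborel {0<..<s} (u l1)"
      by (rule set_integrable_subset[OF convex_left_deriv_integrable[OF e_props(1,2)]]) (use s in auto)
    have c_int: "set_integrable lborel {0<..<s} (\<lambda>_. c)" "(LINT t:{0<..<s}|lborel. c) = c * s" for c :: real
      using s by (auto simp: set_integrable_def set_lebesgue_integral_def intro!: integrable_real_indicator)
    have "u l2 t = l2 / l1 * (u l1 t - 2 * \<gamma> * \<mu>) + 2 * \<gamma> * \<mu>" if "t \<in> {0<..<s}" for t
      using u_q[OF l(1), of t] u_q[OF l2, of t] eq[of t] that s l by simp
    then have "e l2 s = (LINT t:{0<..<s}|lborel. l2 / l1 * (u l1 t - 2 * \<gamma> * \<mu>) + 2 * \<gamma> * \<mu>)"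
      unfolding LINT_u[OF s, symmetric] by (intro set_lebesgue_integral_cong) auto
    also have "\<dots> = l2 / l1 * (e l1 s - 2 * \<gamma> * \<mu> * s) + 2 * \<gamma> * \<mu> * s"
      by (subst set_integral_add(2))
         (use LINT_u[OF s] u_int c_int in \<open>auto intro!: set_integrable_mult_right set_integral_diff(1) simp: set_integral_diff(2)\<close>)
    also have "\<dots> = 2 * l2 * Q s + 2 * \<gamma> * \<mu> * s"
      using l by (simp add: Q_def)
    finally show ?thesis .
  qed
  define D where "D s = P s - Q s" for s
  have Q_cont: "continuous_on {0..1} Q"
    unfolding Q_def using l by (intro continuous_intros e_props) auto
  have D_cont: "continuous_on {0..1} D"
    unfolding D_def by (intro continuous_intros P_props Q_cont)
  have D0: "D 0 = 0" by (simp add: D_def Q_def P_props e_props)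
  have D1: "D 1 = 0"
    using l by (simp add: D_def Q_def P_props e_1 h1 field_simps)
  have h_ge: "2 * l1 * Q s + 2 * \<gamma> * \<mu> * s \<le> gd s + 2 * (\<gamma> + l1) * P s" if "s \<in> {0..1}" for s
    using convex_env_le[OF h_props(1,2) that, of l1] e_Q1[of s] h_eq[of l1 s] by linarith
  have D_le: "D s \<le> 0" if "s \<in> {0..1}" for s
  proof (rule ccontr)
    assume "\<not> D s \<le> 0"
    have "{0..1::real} \<noteq> {}" by auto
    from continuous_attains_sup[OF compact_Icc this D_cont]
    obtain m where m: "m \<in> {0..1}" "\<And>y. y \<in> {0..1} \<Longrightarrow> D y \<le> D m" by blast
    have Dm: "0 < D m" using m(2)[OF that] \<open>\<not> D s \<le> 0\<close> by simp
    let ?S = "{0..1} \<inter> D -` {D m}"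
    have "closed ?S" by (intro continuous_closed_preimage[OF D_cont]) auto
    then have "compact ?S" by (simp add: compact_eq_bounded_closed bounded_Int)
    then obtain t where t: "t \<in> ?S" "\<And>y. y \<in> ?S \<Longrightarrow> t \<le> y"
      using compact_attains_inf[of ?S] m(1) by blast
    have Dt: "D t = D m" using t by simp
    then have "t \<noteq> 0" "t \<noteq> 1" using D0 D1 Dm by auto
    then have t01: "0 < t" "t < 1" "t \<in> {0..1}" using t(1) by auto
    \<comment> \<open>From \<open>l1\<close> to \<open>l2\<close> the function \<open>h\<close>
      gains \<open>2 * (l2 - l1) * P\<close> and its envelope gains
      \<open>2 * (l2 - l1) * Q\<close>, so contact at \<open>l2\<close> fails wherever
      \<open>P\<close> exceeds \<open>Q\<close>.\<close>
    have "0 < 2 * (l2 - l1) * D t" using l Dm Dt by simp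
    moreover have "2 * l1 * Q t + 2 * \<gamma> * \<mu> * t + 2 * (l2 - l1) * P t \<le> h l2 t"
      using h_ge[OF t01(3)] by (simp add: h_eq algebra_simps)
    moreover have "2 * (l2 - l1) * D t = 2 * (l2 - l1) * P t - 2 * l2 * Q t + 2 * l1 * Q t"
      by (simp add: D_def algebra_simps)
    ultimately have "e l2 t < h l2 t"
      unfolding e_Q2[OF less_imp_le[OF t01(1)] less_imp_le[OF t01(2)]] by linarith
    then obtain \<delta> \<alpha> \<beta> where d: "0 < \<delta>" "0 < t - \<delta>" "t + \<delta> < 1"
      "\<And>s. s \<in> {t-\<delta>..t+\<delta>} \<Longrightarrow> e l2 s = \<alpha> + \<beta> * s"
      using convex_env_locally_affine[OF h_props(1,2) t01(1,2)] by metis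
    \<comment> \<open>The midpoint identity passes to \<open>Q\<close>, so \<open>D\<close> inherits
      midpoint convexity at \<open>t\<close> from \<open>P\<close>. Since \<open>t\<close> is the
      leftmost maximizer, \<open>D (t - \<delta>)\<close> is strictly below the maximum.\<close>
    have "e l2 (t - \<delta>) + e l2 (t + \<delta>) = 2 * e l2 t"
      using d by (simp add: algebra_simps)
    then have "2 * l2 * (Q (t - \<delta>) + Q (t + \<delta>)) = 2 * l2 * (2 * Q t)"
      using d t01 by (simp add: e_Q2 algebra_simps)
    then have Qm: "Q (t - \<delta>) + Q (t + \<delta>) = 2 * Q t" using l2 by simp
    have "P ((1 - 1/2) *\<^sub>R (t - \<delta>) + (1/2) *\<^sub>R (t + \<delta>)) \<le> (1 - 1/2) * P (t - \<delta>) + 1/2 * P (t + \<delta>)"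
      using d t01 by (intro convex_onD[OF P_props(2)]) auto
    moreover have "(1 - 1/2) *\<^sub>R (t - \<delta>) + (1/2) *\<^sub>R (t + \<delta>) = t"
      by (simp add: field_simps)
    ultimately have "2 * P t \<le> P (t - \<delta>) + P (t + \<delta>)" by simp
    then have "2 * D t \<le> D (t - \<delta>) + D (t + \<delta>)" using Qm by (simp add: D_def)
    moreover have "D (t + \<delta>) \<le> D m" "D (t - \<delta>) \<le> D m" using m(2) d t01 by auto
    moreover have "D (t - \<delta>) \<noteq> D m" using t(2)[of "t - \<delta>"] d t01 by auto
    ultimately show False using Dt by linarith
  qed
  \<comment> \<open>Subtracting \<open>2 * l1 * P s\<close> from \<open>h_ge\<close> leaves
    \<open>h 0 s\<close> on the right, and \<open>P s \<le> Q s\<close> finishes. The linear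
    function joins the end values of \<open>h 0\<close>, so the envelope can only be this
    chord.\<close>
  have chord: "2 * \<gamma> * \<mu> * s \<le> h 0 s" if s: "s \<in> {0..1}" for s
  proof -
    have "0 \<le> 2 * l1 * (- D s)" using D_le[OF s] l by (intro mult_nonneg_nonneg) auto
    then show ?thesis
      using h_ge[OF s] by (simp add: h_eq D_def algebra_simps)
  qed
  have minorant: "(\<lambda>s. 0 + 2 * \<gamma> * \<mu> * s) \<in> convex_minorants (h 0)"
    unfolding convex_minorants_def using chord
    by (auto intro!: distortionsI_convex convex_on_affine[of _ 0, simplified] continuous_intros)
  have e0: "e 0 s = 0 + 2 * \<gamma> * \<mu> * s" if s: "s \<in> {0..1}" for s
  proof (rule antisym)
    have "e 0 s \<le> (e 0 1 - e 0 0) / (1 - 0) * (s - 0) + e 0 0"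
      by (rule convex_onD_Icc'[OF e_props(1) s])
    then show "e 0 s \<le> 0 + 2 * \<gamma> * \<mu> * s" by (simp add: e_1 h1 e_props(3))
    show "0 + 2 * \<gamma> * \<mu> * s \<le> e 0 s"
      by (rule convex_env_greatest[OF h_props(1,2) minorant s])
  qed
  have "u 0 t = 2 * \<gamma> * \<mu>" if "t \<in> {0<..<1}" for t
    by (rule left_deriv_locally_affine[of 0 t 1]) (use that e0 in auto)
  then have "u 0 constant_on {0<..<1}" unfolding constant_on_def by blast
  then show False using not_constant[of 0] by simp
qed

lemma qopt_left_cont:
  assumes "0 < t" "t < 1"
  shows "(qopt l \<longlongrightarrow> qopt l t) (at_left t)"
  unfolding qopt_affine[abs_def] by (intro tendsto_intros u_left_cont assms)

lemma qopt_eqI: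
  assumes q: "sq_integrable q" "\<And>t. 0 < t \<Longrightarrow> t < 1 \<Longrightarrow> (q \<longlongrightarrow> q t) (at_left t)"
    and l: "0 < l" and le: "inn (\<lambda>t. q t - qopt l t) (\<lambda>t. q t - qopt l t) \<le> 0"
    and t: "t \<in> {0<..<1}"
  shows "q t = qopt l t"
proof -
  have "inn (\<lambda>t. q t - qopt l t) (\<lambda>t. q t - qopt l t) = 0"
    using le inn_self_nonneg by (rule antisym)
  then have "AE t in unif. q t - qopt l t = 0"
    by (intro inn_self_eq_0 sq_integrable_diff q(1) qopt_sq l)
  then have "AE t in unif. q t = qopt l t" by simp
  then show ?thesis
    by (rule AE_unif_eq_left_cont) (use q(2) qopt_left_cont t in auto)
qed

section \<open>The objective of the multiplier and the value of the problem\<close>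

lemma cdf_variance_inn:
  assumes F: "is_cdf F" "sq_integrable (quantile F)"
  shows "cdf_variance F = inn (quantile F) (quantile F) - (mean (quantile F))\<^sup>2"
proof -
  let ?q = "quantile F" and ?m = "mean (quantile F)"
  have m: "cdf_mean F = ?m" by (simp add: cdf_mean_eq[OF F(1)] mean_def)
  have "cdf_variance F = inn (\<lambda>t. ?q t - ?m) (\<lambda>t. ?q t - ?m)"
    by (simp add: cdf_variance_eq[OF F(1)] m inn_def power2_eq_square)
  also have "\<dots> = inn ?q ?q - 2 * inn ?q (\<lambda>_. ?m) + inn (\<lambda>_. ?m) (\<lambda>_. ?m)"
    by (rule sq_dist_expand[OF F(2) sq_integrable_const])
  also have "inn ?q (\<lambda>_. ?m) = ?m * ?m"
    by (subst inn_commute) (simp add: inn_const mean_def)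
  also have "inn (\<lambda>_. ?m) (\<lambda>_. ?m) = ?m * ?m"
    using unif.prob_space by (simp add: inn_def)
  finally show ?thesis by (simp add: power2_eq_square)
qed

definition objective :: "real \<Rightarrow> real" where
  "objective l = (g 1)\<^sup>2 / (4 * (\<gamma> + l)) + (Lam g G \<gamma> l)\<^sup>2 / (4 * l) - l * (cdf_variance G - \<epsilon>)"

text \<open>Splitting \<open>qopt l\<close> into its mean \<open>m\<close> and the centred part
  \<open>r / (2 * l)\<close> produces the term with \<open>Lam\<close>. The rest of the square joins
  \<open>\<gamma> * m\<^sup>2\<close> in \<open>(\<gamma> + l) * m\<^sup>2\<close>, whose expansion
  yields the term with \<open>(g 1)\<^sup>2\<close>, the constant \<open>\<mu> * g 1\<close>, and
  the \<open>\<mu>\<^sup>2\<close> that turns \<open>inn p p\<close> into the variance.\<close>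

lemma dual_eq_objective:
  assumes l: "0 < l"
  shows "dual l = objective l + (\<mu> * g 1 - \<gamma> * (cdf_variance G - \<epsilon>))"
proof -
  define r where "r = (\<lambda>t. u l t - h l 1)"
  have u_sq: "sq_integrable (u l)" using u_sq l by simp
  then have r: "sq_integrable r" unfolding r_def by (intro sq_integrable_intros)
  have rm: "inn r (\<lambda>_. c) = 0" for c
    using sq_integrable_integrable[OF u_sq] u_mean[of l] unif.prob_space
    by (subst inn_commute) (simp add: inn_const r_def)
  define m where "m = \<mu> + g 1 / (2 * (\<gamma> + l))"
  have mq: "mean (qopt l) = m" using qopt_mean[OF l] by (simp add: mean_def m_def)
  have q: "qopt l = (\<lambda>t. 1 / (2 * l) * r t + m)"
    by (simp add: fun_eq_iff qopt_def r_def m_def)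
  have "inn (qopt l) (qopt l) = inn (\<lambda>t. 1 / (2 * l) * r t) (\<lambda>t. 1 / (2 * l) * r t)
      + 2 * inn (\<lambda>t. 1 / (2 * l) * r t) (\<lambda>_. m) + inn (\<lambda>_. m) (\<lambda>_. m)"
    unfolding q by (rule sq_sum_expand[OF sq_integrable_cmult[OF r] sq_integrable_const])
  also have "\<dots> = inn r r / (4 * l\<^sup>2) + m\<^sup>2"
    unfolding inn_cmult_left inn_cmult_right rm using unif.prob_space
    by (simp add: inn_def power2_eq_square)
  finally have qq: "inn (qopt l) (qopt l) = inn r r / (4 * l\<^sup>2) + m\<^sup>2" .
  have Lam: "(Lam g G \<gamma> l)\<^sup>2 = inn r r"
  proof -
    have "(LINT t:{0<..<1}|lborel. (u l t - h l 1)\<^sup>2) = inn r r"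
      unfolding integral_unif[symmetric] by (simp add: inn_def r_def power2_eq_square)
    then show ?thesis unfolding Lam_def using inn_self_nonneg[of r] by simp
  qed
  have var: "cdf_variance G = inn p p - \<mu>\<^sup>2"
    using cdf_variance_inn[OF cdf_G p_sq] by (simp add: mean_def mu_eq)
  have "(\<gamma> + l) * m\<^sup>2 = (\<gamma> + l) * \<mu>\<^sup>2 + \<mu> * g 1 + (g 1)\<^sup>2 / (4 * (\<gamma> + l))"
  proof -
    have nz: "\<gamma> + l \<noteq> 0" using l gamma_pos by simp
    have id: "c * (\<mu> + g 1 / (2 * c))\<^sup>2 = c * \<mu>\<^sup>2 + \<mu> * g 1 + (g 1)\<^sup>2 / (4 * c)" if "c \<noteq> 0" for c :: real
      using that by (simp add: power2_eq_square field_simps)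
    show ?thesis unfolding m_def by (rule id[OF nz])
  qed
  moreover have "dual l = l * (inn r r / (4 * l\<^sup>2)) + (\<gamma> + l) * m\<^sup>2 - (\<gamma> + l) * (inn p p - \<epsilon>)"
    unfolding dual_def qq mq by (simp add: algebra_simps)
  moreover have "l * (inn r r / (4 * l\<^sup>2)) = inn r r / (4 * l)"
    using l by (simp add: power2_eq_square)
  ultimately show ?thesis
    unfolding objective_def Lam var by (simp add: algebra_simps)
qed

lemma ambiguity_set_iff:
  "F \<in> ambiguity_set G \<epsilon> \<longleftrightarrow> is_cdf F \<and> sq_integrable (quantile F) \<and>
     inn (\<lambda>t. quantile F t - p t) (\<lambda>t. quantile F t - p t) \<le> \<epsilon>"
proof -
  have "wasserstein2 F G = sqrt (inn (\<lambda>t. quantile F t - p t) (\<lambda>t. quantile F t - p t))"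
    unfolding wasserstein2_def integral_unif[symmetric] by (simp add: inn_def power2_eq_square)
  then show ?thesis
    by (auto simp: ambiguity_set_def finite_second_moment_iff sq_integrable_def quantile_measurable)
qed

lemma value_eq_lagr:
  assumes F: "finite_risk F"
  shows "riskmetric g F + ereal (\<gamma> * cdf_variance F) =
    ereal (lagr F l + (\<gamma> + l) * (inn (\<lambda>t. quantile F t - p t) (\<lambda>t. quantile F t - p t) - \<epsilon>))"
proof -
  have "is_cdf F" "sq_integrable (quantile F)" using F by (auto simp: finite_risk_def)
  then show ?thesis
    by (simp add: riskmetric_finite[OF F] cdf_variance_inn lagr_def)
qed

text \<open>Feasibility makes the value at most the Lagrangian, which is at most
  \<open>dual l\<close> minus \<open>l\<close> times the squared distance to \<open>qopt l\<close>.
  A feasible \<open>F\<close> reaching \<open>dual l\<close> therefore has distance 0. Assuming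
  \<open>ge\<close> lets one statement serve both the upper bound and uniqueness.\<close>

lemma worst_case_value_le:
  assumes l: "0 < l" and F: "F \<in> ambiguity_set G \<epsilon>"
    and ge: "ereal (dual l) \<le> riskmetric g F + ereal (\<gamma> * cdf_variance F)"
  shows "F = Fopt l" and "riskmetric g F + ereal (\<gamma> * cdf_variance F) = ereal (dual l)"
proof -
  let ?d = "inn (\<lambda>t. quantile F t - qopt l t) (\<lambda>t. quantile F t - qopt l t)"
  let ?N = "inn (\<lambda>t. quantile F t - p t) (\<lambda>t. quantile F t - p t)"
  have F': "is_cdf F" "sq_integrable (quantile F)" "?N \<le> \<epsilon>"
    using F by (auto simp: ambiguity_set_iff)
  have fin: "finite_risk F"
  proof (rule ccontr)
    assume "\<not> finite_risk F"
    then have "riskmetric g F = - \<infinity>" by (rule riskmetric_infinite[OF F'(1,2)])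
    then show False using ge by simp
  qed
  have val: "dual l \<le> lagr F l + (\<gamma> + l) * (?N - \<epsilon>)"
    using ge unfolding value_eq_lagr[OF fin, of l] by simp
  moreover have neg: "(\<gamma> + l) * (?N - \<epsilon>) \<le> 0"
    using F'(3) l gamma_pos by (intro mult_nonneg_nonpos) auto
  ultimately have "l * ?d \<le> 0" using lagr_le[OF l fin] by linarith
  then have d: "?d \<le> 0" using l by (simp add: mult_le_0_iff)
  have "quantile F t = qopt l t" if "t \<in> {0<..<1}" for t
    by (rule qopt_eqI[OF F'(2) quantile_left_cont[OF F'(1)] l d that])
  then show "F = Fopt l"
    by (intro is_cdf_eqI F'(1) Fopt(1)[OF l]) (simp add: Fopt(2)[OF l])
  show "riskmetric g F + ereal (\<gamma> * cdf_variance F) = ereal (dual l)"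
    unfolding value_eq_lagr[OF fin, of l] using val neg lagr_le_dual[OF l fin] by simp
qed

theorem worst_case_solution:
  "\<exists>\<eta> M lstar Fwo. 0 < \<eta> \<and> \<eta> < M \<and>
    (\<forall>l. is_arg_min objective (\<lambda>l. l \<in> {\<eta>..M}) l \<longleftrightarrow> l = lstar) \<and>
    (\<forall>F. is_arg_max (\<lambda>F. riskmetric g F + ereal (\<gamma> * cdf_variance F))
           (\<lambda>F. F \<in> ambiguity_set G \<epsilon>) F \<longleftrightarrow> F = Fwo) \<and>
    (\<forall>t\<in>{0<..<1}. quantile Fwo t = qopt lstar t)"
proof -
  obtain ls where ls: "0 < ls" "slack ls = 0" using ex_zero_slack by blast
  have dual_le: "dual ls + l * inn (\<lambda>t. qopt ls t - qopt l t) (\<lambda>t. qopt ls t - qopt l t) \<le> dual l" if "0 < l" for l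
    using dual_subgradient[OF ls(1) that] ls(2) by simp
  have obj_le: "objective ls \<le> objective l" if "0 < l" for l
  proof -
    have "0 \<le> l * inn (\<lambda>t. qopt ls t - qopt l t) (\<lambda>t. qopt ls t - qopt l t)"
      using that inn_self_nonneg by (intro mult_nonneg_nonneg) auto
    then have "dual ls \<le> dual l" using dual_le[OF that] by linarith
    then show ?thesis by (simp add: dual_eq_objective ls(1) that)
  qed
  have obj_unique: "l = ls" if l: "0 < l" and le: "objective l \<le> objective ls" for l
  proof (rule ccontr)
    assume ne: "l \<noteq> ls"
    have "dual l \<le> dual ls" using le by (simp add: dual_eq_objective ls(1) l)
    then have "l * inn (\<lambda>t. qopt ls t - qopt l t) (\<lambda>t. qopt ls t - qopt l t) \<le> 0"
      using dual_le[OF l] by linarith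
    then have d: "inn (\<lambda>t. qopt ls t - qopt l t) (\<lambda>t. qopt ls t - qopt l t) \<le> 0"
      using l by (simp add: mult_le_0_iff)
    have eq: "qopt ls t = qopt l t" if "t \<in> {0<..<1}" for t
      by (rule qopt_eqI[OF qopt_sq[OF ls(1)] qopt_left_cont l d that])
    from ne consider "ls < l" | "l < ls" by linarith
    then show False
    proof cases
      case 1
      show False by (rule qopt_inj[OF ls(1) 1 eq])
    next
      case 2
      show False by (rule qopt_inj[OF l 2 eq[symmetric]])
    qed
  qed
  have N: "inn (\<lambda>t. quantile (Fopt ls) t - p t) (\<lambda>t. quantile (Fopt ls) t - p t) = \<epsilon>"
  proof -
    have "inn (\<lambda>t. quantile (Fopt ls) t - p t) (\<lambda>t. quantile (Fopt ls) t - p t)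
        = inn (\<lambda>t. qopt ls t - p t) (\<lambda>t. qopt ls t - p t)"
      by (rule inn_cong) (simp_all add: Fopt(2)[OF ls(1)])
    then show ?thesis using ls(2) by (simp add: slack_def)
  qed
  note fin = Fopt_finite_risk[OF ls(1)]
  have opt_in: "Fopt ls \<in> ambiguity_set G \<epsilon>"
    using fin N by (simp add: ambiguity_set_iff finite_risk_def)
  have opt_val: "riskmetric g (Fopt ls) + ereal (\<gamma> * cdf_variance (Fopt ls)) = ereal (dual ls)"
    unfolding value_eq_lagr[OF fin, of ls] N lagr_Fopt[OF ls(1)] by simp
  \<comment> \<open>\<open>ls\<close> minimizes the objective over all positive multipliers, so any
    compact interval of positive numbers containing \<open>ls\<close> would serve as well.\<close>
  have "is_arg_min objective (\<lambda>l. l \<in> {ls / 2..2 * ls}) l \<longleftrightarrow> l = ls" for l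
    unfolding is_arg_min_def
  proof
    assume *: "l \<in> {ls / 2..2 * ls} \<and> \<not> (\<exists>y. y \<in> {ls / 2..2 * ls} \<and> objective y < objective l)"
    have "ls \<in> {ls / 2..2 * ls}" using ls by simp
    then have "objective l \<le> objective ls" using * by (meson not_le)
    moreover have "0 < l" using * ls by auto
    ultimately show "l = ls" by (intro obj_unique)
  next
    assume "l = ls"
    moreover have "\<not> objective y < objective ls" if "y \<in> {ls / 2..2 * ls}" for y
      using obj_le[of y] that ls by (simp add: not_less)
    ultimately show "l \<in> {ls / 2..2 * ls} \<and> \<not> (\<exists>y. y \<in> {ls / 2..2 * ls} \<and> objective y < objective l)"
      using ls by auto
  qed
  moreover have "is_arg_max (\<lambda>F. riskmetric g F + ereal (\<gamma> * cdf_variance F))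
           (\<lambda>F. F \<in> ambiguity_set G \<epsilon>) F \<longleftrightarrow> F = Fopt ls" for F
    unfolding is_arg_max_def
  proof
    assume *: "F \<in> ambiguity_set G \<epsilon> \<and> \<not> (\<exists>y. y \<in> ambiguity_set G \<epsilon> \<and>
        riskmetric g F + ereal (\<gamma> * cdf_variance F) < riskmetric g y + ereal (\<gamma> * cdf_variance y))"
    then have "ereal (dual ls) \<le> riskmetric g F + ereal (\<gamma> * cdf_variance F)"
      using opt_in opt_val by (metis not_le)
    then show "F = Fopt ls" using * by (intro worst_case_value_le(1)[OF ls(1)]) auto
  next
    assume F: "F = Fopt ls"
    have "\<not> ereal (dual ls) < riskmetric g y + ereal (\<gamma> * cdf_variance y)" if "y \<in> ambiguity_set G \<epsilon>" for y
      using worst_case_value_le(2)[OF ls(1) that] by (metis less_imp_le less_irrefl)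
    then show "F \<in> ambiguity_set G \<epsilon> \<and> \<not> (\<exists>y. y \<in> ambiguity_set G \<epsilon> \<and>
        riskmetric g F + ereal (\<gamma> * cdf_variance F) < riskmetric g y + ereal (\<gamma> * cdf_variance y))"
      unfolding F opt_val using opt_in by blast
  qed
  ultimately show ?thesis
    using ls(1) Fopt(2)[OF ls(1)]
    by (intro exI[of _ "ls / 2"] exI[of _ "2 * ls"] exI[of _ ls] exI[of _ "Fopt ls"]) simp
qed

end

theorem theorem5p1:
  fixes G g :: "real \<Rightarrow> real" and \<epsilon> \<gamma> :: real
  assumes "is_cdf G" and "finite_second_moment G" and "cdf_variance G > 0"
    and "\<epsilon> > 0" and "\<gamma> > 0" and "g \<in> distortions"
    and "set_integrable lborel {0<..<1}
           (\<lambda>t. (left_deriv (convex_env (dual_distortion g)) t)\<^sup>2)"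
    and "\<And>l. l \<ge> 0 \<Longrightarrow> \<not> left_deriv (convex_env (h_fun g G \<gamma> l)) constant_on {0<..<1}"
  shows "\<exists>\<eta> M lstar Fwo. 0 < \<eta> \<and> \<eta> < M \<and>
    (\<forall>l. is_arg_min
           (\<lambda>l. (g 1)\<^sup>2 / (4 * (\<gamma> + l)) + (Lam g G \<gamma> l)\<^sup>2 / (4 * l) - l * (cdf_variance G - \<epsilon>))
           (\<lambda>l. l \<in> {\<eta>..M}) l \<longleftrightarrow> l = lstar) \<and>
    (\<forall>F. is_arg_max (\<lambda>F. riskmetric g F + ereal (\<gamma> * cdf_variance F))
           (\<lambda>F. F \<in> ambiguity_set G \<epsilon>) F \<longleftrightarrow> F = Fwo) \<and>
    (\<forall>t\<in>{0<..<1}. quantile Fwo t =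
        cdf_mean G + g 1 / (2 * (\<gamma> + lstar))
        + (left_deriv (convex_env (h_fun g G \<gamma> lstar)) t - h_fun g G \<gamma> lstar 1) / (2 * lstar))"
proof -
  interpret worst_case G g \<epsilon> \<gamma>
    by unfold_locales (use assms in auto)
  show ?thesis
    using worst_case_solution unfolding objective_def[abs_def] qopt_def .
qed

end
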